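(* Let $\frac{p}{q}\in\mathbb{Q}\cap[0,1]$ be given with $\frac{p}{q}=\frac{p_1}{q_1}\oplus\frac{p_2}{q_2}$ (Farey sum, with left parent $\frac{p_1}{q_1}$ and right parent $\frac{p_2}{q_2}$), and for $j\ge 0$ let $l_j=\frac{jp+p_1}{jq+q_1}$ and $r_j=\frac{jp+p_2}{jq+q_2}$. Let $\{F_{a,b}\}$ be a family of lifts in Class $\mathcal{N}$. Let $T_{\frac{p}{q}}$ denote a tip of $Lock_{\frac{p}{q}}$ and, for each $j\ge 0$, let $T_{l_j}$ and $T_{r_j}$ denote tips of $Lock_{l_j}$ and $Lock_{r_j}$ respectively. Then for each $j\ge 0$, $$T_{l_j}\in\mathcal{L}_{\frac{p}{q}},\qquad T_{r_j}\in\mathcal{R}_{\frac{p}{q}},\qquad T_{\frac{p}{q}}\in\mathcal{R}_{l_j},\qquad T_{\frac{p}{q}}\in\mathcal{L}_{r_j}.$$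
   Context: A degree-one lift is a continuous $F:\mathbb{R}\to\mathbb{R}$ with $F(x+1)=F(x)+1$ for all $x$. Its rotation set $Rot(F)$ is the set of all values $\lim_{m\to\infty}\frac{F^m(x)-x}{m}$ over those $x\in\mathbb{R}$ for which the limit exists; it is a single point or a nondegenerate closed interval. Its lower and upper monotone bounds are $F_l(x)=\inf\{F(y)\mid y\ge x\}$ and $F_u(x)=\sup\{F(y)\mid y\le x\}$. Class $\mathcal{B}$: lifts $F$ of degree-one circle maps that are $C^3$, piecewise strictly monotone, have at most two critical points (per fundamental domain $[0,1)$), both turning points when there are two, and have negative Schwarzian derivative $S(F)=\frac{F'''}{F'}-\frac32\left(\frac{F''}{F'}\right)^2$ (where defined) when they have two critical points. When $F$ has two turning points per fundamental domain, the origin is chosen so that the locations in $[0,1)$ of the maximum, $C$, and the minimum, $K$, satisfy $C<K$. $K^-$ is the closest point to $K$ below $K$ with $F(K^-)=F(K)$, and $C^+$ is the closest point to $C$ above $C$ with $F(C^+)=F(C)$. Class $\mathcal{N}$: two-parameter families of lifts $\{F_{a,b}\}$ (with $a\in\mathbb{R}$ and $b$ real) such that (i) each $F_{a,b}$ is in Class $\mathcal{B}$; (ii) $F_{a,b}$ and $\frac{d}{dx}F_{a,b}$ depend continuously on $(a,b)$; (iii) $a$ is a translation parameter: $F_{a,b}=F_{0,b}+a$; (iv) the Hausdorff distance $\Delta$ between (the graphs of) the upper and lower monotone bounds of $F_{a,b}$ is a nondecreasing function of $b$ such that the value $0$ can be attained and the value $1$ can be exceeded. The critical line is the horizontal line $b=\max\{b\mid\Delta=0\}$.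 On it $F_{a,b}$ has a unique critical point in $[0,1)$, and above it $F_{a,b}$ has two. On the critical line one sets $K^-=C=K=C^+$ equal to this critical point. The origin is chosen so that $0<K^-\le C\le K\le C^+<1$ when $0\le\Delta<1$. The points $K^-,C,K,C^+$ depend on $b$ but not on $a$. $Lock_\omega$ is the set of $(a,b)$ with $Rot(F_{a,b})=\{\omega\}$. A tip of $Lock_{\frac{p}{q}}$ is a point $(a_0,b_0)$, with $b_0$ on or above the critical line, such that $(a,b_0)\in Lock_{\frac{p}{q}}$ if and only if $a=a_0$. For $\frac{p}{q}\in\mathbb{Q}\cap[0,1]$ in lowest terms define the loci (on or above the critical line) $\mathcal{R}_{\frac{p}{q}}=\{(a,b)\mid F_{a,b}^q(K^-)=C^++p;\ F_{a,b}^i(K^-)\notin(K^-,K]+\mathbb{Z}\text{ for }0<i\le q;\ F_{a,b}^i(K^-)\ne C^++p\text{ for }0<i<q\}$, $\mathcal{L}_{\frac{p}{q}}=\{(a,b)\mid F_{a,b}^q(C^+)=K^-+p;\ F_{a,b}^i(C^+)\notin[C,C^+)+\mathbb{Z}\text{ for }0<i\le q;\ F_{a,b}^i(C^+)\ne K^-+p\text{ for }0<i<q\}$, where on the critical line the second and third restrictions are dropped in each case. All fractions are in lowest terms and in $[0,1]$. Fractions $\frac{p_1}{q_1},\frac{p_2}{q_2}$ are Farey neighbors if $p_1q_2-p_2q_1=\pm1$; their Farey sum is then $\frac{p_1}{q_1}\oplus\frac{p_2}{q_2}=\frac{p_1+p_2}{q_1+q_2}$. Every rational in $(0,1)$ is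 uniquely a Farey sum $\frac{p_1}{q_1}\oplus\frac{p_2}{q_2}$ with $\frac{p_1}{q_1}<\frac{p_2}{q_2}$; $\frac{p_1}{q_1}$ is its left parent and $\frac{p_2}{q_2}$ its right parent.
   Formalization: When l_0 = 0/1 the printed claim fails: at a tip of Lock_0, F(C^+) = C^+ = K^- + 1, violating the third restriction of L_{1/q}; there only the other conditions are asserted. The origin condition 0 < K^-, C^+ < 1 is required only when C^+ - K^- < 1. *)

theory Defs
  imports "HOL-Analysis.Analysis"
begin

section \<open>Degree-one lifts, rotation sets and monotone bounds\<close>

definition degree_one_lift :: "(real \<Rightarrow> real) \<Rightarrow> bool" where
  "degree_one_lift f \<longleftrightarrow> continuous_on UNIV f \<and> (\<forall>x. f (x + 1) = f x + 1)"

definition Rot :: "(real \<Rightarrow> real) \<Rightarrow> real set" where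
  "Rot f = {\<rho>. \<exists>x. (\<lambda>m. ((f ^^ m) x - x) / real m) \<longlonglongrightarrow> \<rho>}"

definition lower_bound :: "(real \<Rightarrow> real) \<Rightarrow> real \<Rightarrow> real" where
  "lower_bound f x = (INF y\<in>{x..}. f y)"

definition upper_bound :: "(real \<Rightarrow> real) \<Rightarrow> real \<Rightarrow> real" where
  "upper_bound f x = (SUP y\<in>{..x}. f y)"

text \<open>
  Meaningful only when both suprema are bounded. This is the case for the graphs of the two
  monotone bounds of a degree-one lift, which lie at bounded vertical distance from each other.
\<close>

definition hausdorff_dist :: "'a::metric_space set \<Rightarrow> 'a set \<Rightarrow> real" where
  "hausdorff_dist A B = max (SUP x\<in>A. infdist x B) (SUP y\<in>B. infdist y A)"

definition graph_of :: "(real \<Rightarrow> real) \<Rightarrow> (real \<times> real) set" where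
  "graph_of f = {(x, f x) | x. True}"

definition Delta :: "(real \<Rightarrow> real) \<Rightarrow> real" where
  "Delta f = hausdorff_dist (graph_of (upper_bound f)) (graph_of (lower_bound f))"


section \<open>Class B\<close>

definition C3 :: "(real \<Rightarrow> real) \<Rightarrow> bool" where
  "C3 f \<longleftrightarrow> (\<forall>k<3. \<forall>x. (deriv ^^ k) f differentiable (at x)) \<and> continuous_on UNIV ((deriv ^^ 3) f)"

definition piecewise_strictly_monotone :: "(real \<Rightarrow> real) \<Rightarrow> bool" where
  "piecewise_strictly_monotone f \<longleftrightarrow>
     (\<exists>S. finite S \<and> (\<forall>u v. 0 \<le> u \<and> u < v \<and> v \<le> 1 \<and> {u<..<v} \<inter> S = {} \<longrightarrow>
        strict_mono_on {u..v} f \<or> strict_antimono_on {u..v} f))"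

definition critical_points :: "(real \<Rightarrow> real) \<Rightarrow> real set" where
  "critical_points f = {x \<in> {0..<1}. deriv f x = 0}"

definition turning_max :: "(real \<Rightarrow> real) \<Rightarrow> real \<Rightarrow> bool" where
  "turning_max f x \<longleftrightarrow> (\<exists>e>0. strict_mono_on {x - e..x} f \<and> strict_antimono_on {x..x + e} f)"

definition turning_min :: "(real \<Rightarrow> real) \<Rightarrow> real \<Rightarrow> bool" where
  "turning_min f x \<longleftrightarrow> (\<exists>e>0. strict_antimono_on {x - e..x} f \<and> strict_mono_on {x..x + e} f)"

definition schwarzian :: "(real \<Rightarrow> real) \<Rightarrow> real \<Rightarrow> real" where
  "schwarzian f x = (deriv ^^ 3) f x / deriv f x - 3 / 2 * ((deriv ^^ 2) f x / deriv f x)\<^sup>2"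

definition class_B :: "(real \<Rightarrow> real) \<Rightarrow> bool" where
  "class_B f \<longleftrightarrow>
     degree_one_lift f \<and> C3 f \<and> piecewise_strictly_monotone f \<and>
     finite (critical_points f) \<and> card (critical_points f) \<le> 2 \<and>
     (card (critical_points f) = 2 \<longrightarrow>
        (\<forall>x\<in>critical_points f. turning_max f x \<or> turning_min f x) \<and>
        (\<forall>x. deriv f x \<noteq> 0 \<longrightarrow> schwarzian f x < 0))"


section \<open>The critical line and the distinguished points\<close>

text \<open>
  A family is a function \<open>F a b x\<close>. Under condition (iii) of Class N the maps \<open>F a b\<close> and \<open>F 0 b\<close>
  differ by a constant, so \<open>Delta\<close> and the points below depend on \<open>b\<close> only and are read off
  from \<open>F 0 b\<close>.
\<close>

type_synonym family = "real \<Rightarrow> real \<Rightarrow> real \<Rightarrow> real"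

definition critical_height :: "family \<Rightarrow> real" where
  "critical_height F = (GREATEST b. Delta (F 0 b) = 0)"

definition the_critical_point :: "(real \<Rightarrow> real) \<Rightarrow> real" where
  "the_critical_point f = (THE x. x \<in> critical_points f)"

definition max_loc :: "(real \<Rightarrow> real) \<Rightarrow> real" where
  "max_loc f = (THE x. x \<in> {0..<1} \<and> turning_max f x)"

definition min_loc :: "(real \<Rightarrow> real) \<Rightarrow> real" where
  "min_loc f = (THE x. x \<in> {0..<1} \<and> turning_min f x)"

definition C_pt :: "family \<Rightarrow> real \<Rightarrow> real" where
  "C_pt F b = (if b = critical_height F then the_critical_point (F 0 b) else max_loc (F 0 b))"

definition K_pt :: "family \<Rightarrow> real \<Rightarrow> real" where
  "K_pt F b = (if b = critical_height F then the_critical_point (F 0 b) else min_loc (F 0 b))"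

definition K_minus :: "family \<Rightarrow> real \<Rightarrow> real" where
  "K_minus F b =
     (if b = critical_height F then the_critical_point (F 0 b)
      else (GREATEST y. y < K_pt F b \<and> F 0 b y = F 0 b (K_pt F b)))"

definition C_plus :: "family \<Rightarrow> real \<Rightarrow> real" where
  "C_plus F b =
     (if b = critical_height F then the_critical_point (F 0 b)
      else (LEAST y. C_pt F b < y \<and> F 0 b y = F 0 b (C_pt F b)))"


section \<open>Class N\<close>

text \<open>
  Joint continuity in \<open>(a, b, x)\<close> is, by compactness of the circle, the same as continuity of
  \<open>(a, b) \<mapsto> F a b\<close> and of \<open>(a, b) \<mapsto> deriv (F a b)\<close> in the topology of uniform convergence.

  The origin is normalised by the last two conjuncts. The interval from \<open>K_minus\<close> to \<open>C_plus\<close>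
  fits into \<open>(0, 1)\<close> for some choice of origin iff it is shorter than 1, i.e. iff the vertical
  distance \<open>SUP x. upper_bound f x - lower_bound f x\<close> is less than 1, and the last conjunct asks
  for it in exactly that case. It cannot be asked for whenever the Hausdorff distance \<open>Delta\<close> is
  less than 1: \<open>Delta\<close> is still less than 1 at a parameter where \<open>C_plus = K_minus + 1\<close>, and such
  a parameter exists as soon as \<open>Delta\<close> exceeds 1 somewhere, so no family would qualify.
\<close>

definition class_N :: "family \<Rightarrow> bool" where
  "class_N F \<longleftrightarrow>
     (\<forall>a b. class_B (F a b)) \<and>
     continuous_on UNIV (\<lambda>(a, b, x). F a b x) \<and>
     continuous_on UNIV (\<lambda>(a, b, x). deriv (F a b) x) \<and>
     (\<forall>a b x. F a b x = F 0 b x + a) \<and>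
     (\<forall>a. mono (\<lambda>b. Delta (F a b)) \<and> (\<exists>b. Delta (F a b) = 0) \<and> (\<exists>b. Delta (F a b) > 1)) \<and>
     (\<forall>b>critical_height F. C_pt F b < K_pt F b) \<and>
     (\<forall>b\<ge>critical_height F. C_plus F b - K_minus F b < 1 \<longrightarrow>
        0 < K_minus F b \<and> K_minus F b \<le> C_pt F b \<and> C_pt F b \<le> K_pt F b \<and>
        K_pt F b \<le> C_plus F b \<and> C_plus F b < 1)"


section \<open>Locking regions, tips and loci\<close>

definition Lock :: "family \<Rightarrow> real \<Rightarrow> (real \<times> real) set" where
  "Lock F \<omega> = {(a, b). Rot (F a b) = {\<omega>}}"

definition is_tip :: "family \<Rightarrow> real \<Rightarrow> real \<times> real \<Rightarrow> bool" where
  "is_tip F \<omega> T \<longleftrightarrow>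
     critical_height F \<le> snd T \<and> (\<forall>a. (a, snd T) \<in> Lock F \<omega> \<longleftrightarrow> a = fst T)"

definition plus_Ints :: "real set \<Rightarrow> real set" where
  "plus_Ints S = {x + of_int n | x n. x \<in> S}"

definition R_locus :: "family \<Rightarrow> nat \<Rightarrow> nat \<Rightarrow> (real \<times> real) set" where
  "R_locus F p q = {(a, b).
     critical_height F \<le> b \<and>
     (F a b ^^ q) (K_minus F b) = C_plus F b + real p \<and>
     (critical_height F < b \<longrightarrow>
        (\<forall>i. 0 < i \<and> i \<le> q \<longrightarrow> (F a b ^^ i) (K_minus F b) \<notin> plus_Ints {K_minus F b<..K_pt F b}) \<and>
        (\<forall>i. 0 < i \<and> i < q \<longrightarrow> (F a b ^^ i) (K_minus F b) \<noteq> C_plus F b + real p))}"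

text \<open>
  \<open>L_return\<close> is \<open>L_locus\<close> without the requirement that \<open>q\<close> be the first time at which
  \<open>K_minus + p\<close> is hit. It is needed for the fraction 0/1 only: at a tip of \<open>Lock F 0\<close> one has
  \<open>C_plus = K_minus + 1\<close>, and this is a fixed point of the lift. So for \<open>p = 1\<close> the orbit of
  \<open>C_plus\<close> satisfies the return condition, but it is at \<open>K_minus + p\<close> at all times, and the tip
  is in \<open>L_return F 1 q\<close> but not in \<open>L_locus F 1 q\<close> if \<open>q \<ge> 2\<close>.
\<close>

definition L_return :: "family \<Rightarrow> nat \<Rightarrow> nat \<Rightarrow> (real \<times> real) set" where
  "L_return F p q = {(a, b).
     critical_height F \<le> b \<and>
     (F a b ^^ q) (C_plus F b) = K_minus F b + real p \<and>
     (critical_height F < b \<longrightarrow>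
        (\<forall>i. 0 < i \<and> i \<le> q \<longrightarrow> (F a b ^^ i) (C_plus F b) \<notin> plus_Ints {C_pt F b..<C_plus F b}))}"

definition L_locus :: "family \<Rightarrow> nat \<Rightarrow> nat \<Rightarrow> (real \<times> real) set" where
  "L_locus F p q = {(a, b).
     (a, b) \<in> L_return F p q \<and>
     (critical_height F < b \<longrightarrow>
        (\<forall>i. 0 < i \<and> i < q \<longrightarrow> (F a b ^^ i) (C_plus F b) \<noteq> K_minus F b + real p))}"


section \<open>Farey fractions\<close>

text \<open>The pair \<open>p\<close>, \<open>q\<close> represents the fraction \<open>p / q\<close> in lowest terms in \<open>[0, 1]\<close>.\<close>

definition reduced_frac :: "nat \<Rightarrow> nat \<Rightarrow> bool" where
  "reduced_frac p q \<longleftrightarrow> 0 < q \<and> coprime p q \<and> p \<le> q"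

definition farey_neighbors :: "nat \<Rightarrow> nat \<Rightarrow> nat \<Rightarrow> nat \<Rightarrow> bool" where
  "farey_neighbors p1 q1 p2 q2 \<longleftrightarrow> \<bar>int p1 * int q2 - int p2 * int q1\<bar> = 1"

definition farey_parents :: "nat \<Rightarrow> nat \<Rightarrow> nat \<Rightarrow> nat \<Rightarrow> nat \<Rightarrow> nat \<Rightarrow> bool" where
  "farey_parents p q p1 q1 p2 q2 \<longleftrightarrow>
     reduced_frac p q \<and> reduced_frac p1 q1 \<and> reduced_frac p2 q2 \<and>
     farey_neighbors p1 q1 p2 q2 \<and> real p1 / real q1 < real p2 / real q2 \<and>
     p = p1 + p2 \<and> q = q1 + q2"

end

theory Submission
  imports Defs
begin

text \<open>
  At a tip of the locking region of \<open>p / q\<close> the lower monotone bound satisfies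
  \<open>(fl ^^ q) x \<le> x + p\<close> and the upper one \<open>(fu ^^ q) x \<ge> x + p\<close>, both with equality somewhere:
  otherwise a small translation would not leave the region. Hence periodic points of \<open>fl\<close> avoid
  \<open>(K_minus, K]\<close> and those of \<open>fu\<close> avoid \<open>[C, C_plus)\<close> modulo 1, so both are periodic points of
  \<open>f\<close> itself. Two such orbits interlace as \<open>Y k < X k \<le> Y (k + 1)\<close>. The map \<open>f\<close> is increasing on
  the intervals \<open>[X k, Y (k + 1)]\<close>, or else the iterate \<open>f ^^ q\<close> would be a translation on
  \<open>[Y k, X k]\<close>, and \<open>f ^^ q\<close> has derivative at least 1 at their endpoints; negative Schwarzian derivative
  forbids this unless they degenerate, so the two orbits coincide. If
  \<open>K_minus\<close> or \<open>C_plus\<close> were not on the common orbit, \<open>f ^^ q\<close> would be a translation on one side of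
  it. Thus \<open>K_minus\<close> and \<open>C_plus\<close> are consecutive points of one periodic orbit on which \<open>f\<close> acts like
  a rotation by \<open>p / q\<close>, and the loci are read off from \<open>q' * p - p' * q = \<plusminus> 1\<close>.
\<close>

section \<open>Monotone lifts and their rotation number\<close>

text \<open>That \<open>Rot f\<close> is an interval never enters. A singleton \<open>Rot f\<close>
  is used only through the two monotone bounds: each of them shares a full forward orbit with
  \<open>f\<close>, so its rotation number belongs to \<open>Rot f\<close>. Conversely, monotone
  maps below and above that have equal rotation numbers pin down the rotation set of the map between
  them.

  Both contradictions with the Schwarzian derivative come from the strictness of one two-point
  inequality: with slopes at least 1 at both ends, an iterate would have to stretch an interval
  whose ends it moves by the same amount. The inequality needs positive derivatives along the whole
  orbit of the interval, so the position of the turning points relative to the orbits has to be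
  settled before each use.

  The fraction 0 is exceptional: its orbits are fixed points, so the first-hit conditions of the
  loci, which rest on the points of an orbit being distinct, are derived for \<open>p > 0\<close>
  only.

  All four claims reduce to two statements about one tip of \<open>p / q\<close>: it lies in the
  \<open>R\<close> locus of \<open>p' / q'\<close> if \<open>q' * p - p' * q = 1\<close>, and in the
  \<open>L\<close> locus if \<open>p' * q - q' * p = 1\<close>.\<close>

definition is_lift :: "(real \<Rightarrow> real) \<Rightarrow> bool" where
  "is_lift g \<longleftrightarrow> (\<forall>x. g (x + 1) = g x + 1)"

lemma lift_add_nat:
  assumes "is_lift g"
  shows "g (x + real n) = g x + real n"
proof (induction n)
  case (Suc n)
  have "g (x + real (Suc n)) = g ((x + real n) + 1)" by (simp add: algebra_simps)
  also have "\<dots> = g x + real (Suc n)" using assms Suc by (simp add: is_lift_def)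
  finally show ?case .
qed simp

lemma lift_add_int:
  assumes "is_lift g"
  shows "g (x + of_int n) = g x + of_int n"
proof (cases "n \<ge> 0")
  case True
  then show ?thesis using lift_add_nat[OF assms, of x "nat n"] by simp
next
  case False
  then show ?thesis using lift_add_nat[OF assms, of "x + of_int n" "nat (- n)"] by simp
qed

lemma is_lift_funpow: "is_lift g \<Longrightarrow> is_lift (g ^^ i)"
  by (induction i) (auto simp: is_lift_def)

lemmas funpow_add_int = lift_add_int[OF is_lift_funpow]

lemma funpow_le_funpow:
  fixes g h :: "real \<Rightarrow> real"
  assumes "\<And>x. g x \<le> h x" and "mono g \<or> mono h" and "x \<le> y"
  shows "(g ^^ i) x \<le> (h ^^ i) y"
proof (induction i)
  case (Suc i)
  from assms(2) show ?case
  proof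
    assume "mono g"
    then have "g ((g ^^ i) x) \<le> g ((h ^^ i) y)" using Suc by (rule monoD)
    then show ?thesis using assms(1)[of "(h ^^ i) y"] by simp
  next
    assume "mono h"
    then have "h ((g ^^ i) x) \<le> h ((h ^^ i) y)" using Suc by (rule monoD)
    then show ?thesis using assms(1)[of "(g ^^ i) x"] by simp
  qed
qed (use assms in simp)

lemma continuous_on_funpow:
  fixes g :: "real \<Rightarrow> real"
  assumes "continuous_on UNIV g"
  shows "continuous_on UNIV (g ^^ i)"
proof (induction i)
  case (Suc i)
  then show ?case using assms
    by (auto intro!: continuous_on_compose2[of UNIV g UNIV "g ^^ i"] simp: comp_def)
qed (simp add: id_def)

lemma lift_fundamental_domain:
  fixes x :: real
  obtains n :: int where "0 \<le> x + of_int n" "x + of_int n < 1"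
  by (rule that[of "- \<lfloor>x\<rfloor>"]) linarith+

lemma lift_displacement_bounded:
  assumes "is_lift f" "continuous_on UNIV f"
  obtains M where "\<And>x. \<bar>f x - x\<bar> \<le> M"
proof -
  have "compact ((\<lambda>x. f x - x) ` {0..1})"
    by (intro compact_continuous_image continuous_intros continuous_on_subset[OF assms(2)]) auto
  then obtain M where M: "\<And>x. x \<in> {0..1} \<Longrightarrow> \<bar>f x - x\<bar> \<le> M"
    by (meson bounded_real compact_imp_bounded imageI)
  have "\<bar>f x - x\<bar> \<le> M" for x
  proof -
    obtain n where "0 \<le> x + of_int n" "x + of_int n < 1" by (rule lift_fundamental_domain)
    then show ?thesis using M[of "x + of_int n"] lift_add_int[OF assms(1), of x n] by simp
  qed
  then show ?thesis by (rule that)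
qed

text \<open>Asks for the limit at every point, which is more than \<open>Rot g = {\<rho>}\<close>,
  where some orbits may have no limit.\<close>

definition has_rotation_number :: "(real \<Rightarrow> real) \<Rightarrow> real \<Rightarrow> bool" where
  "has_rotation_number g \<rho> \<longleftrightarrow> (\<forall>x. (\<lambda>m. ((g ^^ m) x - x) / real m) \<longlonglongrightarrow> \<rho>)"

text \<open>If \<open>y + n \<le> x \<le> y + n + 1\<close>, then monotonicity and periodicity keep
  this true for all iterates, so the difference of the two points stays in one interval of length
  1.\<close>

lemma mono_lift_displacement:
  assumes "mono g" "is_lift g"
  shows "\<bar>((g ^^ m) x - x) - ((g ^^ m) y - y)\<bar> \<le> 1"
proof -
  define n where "n = \<lfloor>x - y\<rfloor>"
  have n: "y + of_int n \<le> x" "x \<le> y + of_int (n + 1)" unfolding n_def by linarith+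
  have "(g ^^ m) (y + of_int n) \<le> (g ^^ m) x" "(g ^^ m) x \<le> (g ^^ m) (y + of_int (n + 1))"
    using n funpow_mono[OF assms(1)] by blast+
  then show ?thesis using n unfolding funpow_add_int[OF assms(2)] by auto
qed

lemma mono_lift_displacement_mult:
  assumes "mono g" "is_lift g"
  shows "\<bar>((g ^^ (k * n)) x - x) - real k * ((g ^^ n) x - x)\<bar> \<le> real k"
proof (induction k)
  case (Suc k)
  have "(g ^^ (Suc k * n)) x = (g ^^ n) ((g ^^ (k * n)) x)"
    by (simp add: funpow_add)
  then show ?case
    using Suc mono_lift_displacement[OF assms, of n "(g ^^ (k * n)) x" x]
    by (simp add: algebra_simps abs_le_iff)
qed simp

lemma mono_lift_has_rotation_number:
  assumes "mono g" "is_lift g"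
  obtains \<rho> where "has_rotation_number g \<rho>"
proof -
  define a where "a m x = (g ^^ m) x - x" for m x
  \<comment> \<open>Both averages are compared with the one at time \<open>m * n\<close>.\<close>
  have key: "\<bar>a m x / m - a n x / n\<bar> \<le> 1 / m + 1 / n" if "m > 0" "n > 0" for m n :: nat and x
  proof -
    have "\<bar>a (m * n) x - m * a n x\<bar> \<le> m" "\<bar>a (m * n) x - n * a m x\<bar> \<le> n"
      using mono_lift_displacement_mult[OF assms, of m n x]
        mono_lift_displacement_mult[OF assms, of n m x]
      by (simp_all add: a_def mult.commute)
    then have "\<bar>n * a m x - m * a n x\<bar> \<le> real m + real n" by linarith
    then have "\<bar>n * a m x - m * a n x\<bar> / (real m * real n) \<le> (real m + real n) / (real m * real n)"
      by (intro divide_right_mono) auto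
    moreover have "\<bar>n * a m x - m * a n x\<bar> / (real m * real n) = \<bar>a m x / m - a n x / n\<bar>"
    proof -
      have "a m x / m - a n x / n = (n * a m x - m * a n x) / (real m * real n)"
        using that by (simp add: field_simps)
      then show ?thesis by (simp add: abs_divide abs_mult)
    qed
    moreover have "(real m + real n) / (real m * real n) = 1 / m + 1 / n"
      using that by (simp add: field_simps)
    ultimately show ?thesis by simp
  qed
  have "Cauchy (\<lambda>m. a m 0 / real m)"
  proof (rule metric_CauchyI)
    fix e :: real assume e: "e > 0"
    obtain N :: nat where N: "real N > 2 / e" using reals_Archimedean2 by blast
    have "dist (a m 0 / real m) (a n 0 / real n) < e" if "m \<ge> N" "n \<ge> N" for m n
    proof -
      have "0 < 2 / e" using e by simp
      then have N0: "real N > 0" using N by linarith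
      have pos: "m > 0" "n > 0" using N0 that by auto
      have "1 / real m \<le> 1 / real N" "1 / real n \<le> 1 / real N"
        using that N0 by (auto intro!: divide_left_mono)
      moreover have "1 / real N < e / 2" using N N0 e by (simp add: field_simps)
      ultimately show ?thesis using key[OF pos, of 0] unfolding dist_real_def by linarith
    qed
    then show "\<exists>N. \<forall>m\<ge>N. \<forall>n\<ge>N. dist (a m 0 / real m) (a n 0 / real n) < e" by blast
  qed
  then obtain \<rho> where \<rho>: "(\<lambda>m. a m 0 / real m) \<longlonglongrightarrow> \<rho>"
    by (auto simp: Cauchy_convergent_iff convergent_def)
  have "(\<lambda>m. a m x / real m) \<longlonglongrightarrow> \<rho>" for x
  proof -
    have "(\<lambda>m. a m x / real m - a m 0 / real m) \<longlonglongrightarrow> 0"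
    proof (rule Lim_null_comparison)
      show "\<forall>\<^sub>F m in sequentially. norm (a m x / real m - a m 0 / real m) \<le> 1 / real m"
        using eventually_gt_at_top[of "0 :: nat"]
      proof eventually_elim
        case (elim m)
        have "\<bar>a m x - a m 0\<bar> / real m \<le> 1 / real m"
          using mono_lift_displacement[OF assms, of m x 0]
          by (intro divide_right_mono) (auto simp: a_def)
        then show ?case by (simp add: diff_divide_distrib[symmetric] abs_divide)
      qed
      show "(\<lambda>m. 1 / real m) \<longlonglongrightarrow> 0" by (rule lim_1_over_n)
    qed
    from tendsto_add[OF this \<rho>] show ?thesis by simp
  qed
  then show ?thesis using that by (auto simp: has_rotation_number_def a_def)
qed

lemma has_rotation_number_subseq:
  assumes "has_rotation_number g \<rho>" "q > 0"
  shows "(\<lambda>k. ((g ^^ (k * q)) x - x) / real (k * q)) \<longlonglongrightarrow> \<rho>"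
proof -
  have "(\<lambda>m. ((g ^^ m) x - x) / real m) \<longlonglongrightarrow> \<rho>"
    using assms by (auto simp: has_rotation_number_def)
  moreover have "strict_mono (\<lambda>k. k * q)" using assms(2) by (auto simp: strict_mono_def)
  ultimately show ?thesis
    using LIMSEQ_subseq_LIMSEQ by (fastforce simp: comp_def)
qed

lemma rotation_number_ge:
  assumes "has_rotation_number g \<rho>" "q > 0"
    and "\<And>k. (g ^^ (k * q)) x \<ge> x + real k * c"
  shows "\<rho> \<ge> c / real q"
proof (rule LIMSEQ_le_const[OF has_rotation_number_subseq[OF assms(1,2)]])
  show "\<exists>N. \<forall>n\<ge>N. c / real q \<le> ((g ^^ (n * q)) x - x) / real (n * q)"
  proof (intro exI allI impI)
    fix n :: nat assume "n \<ge> 1"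
    have "c / real q = (real n * c) / real (n * q)" using \<open>n \<ge> 1\<close> by simp
    also have "\<dots> \<le> ((g ^^ (n * q)) x - x) / real (n * q)"
      using assms(3)[of n] by (intro divide_right_mono) auto
    finally show "c / real q \<le> ((g ^^ (n * q)) x - x) / real (n * q)" .
  qed
qed

lemma rotation_number_le:
  assumes "has_rotation_number g \<rho>" "q > 0"
    and "\<And>k. (g ^^ (k * q)) x \<le> x + real k * c"
  shows "\<rho> \<le> c / real q"
proof (rule LIMSEQ_le_const2[OF has_rotation_number_subseq[OF assms(1,2)]])
  show "\<exists>N. \<forall>n\<ge>N. ((g ^^ (n * q)) x - x) / real (n * q) \<le> c / real q"
  proof (intro exI allI impI)
    fix n :: nat assume "n \<ge> 1"
    have "((g ^^ (n * q)) x - x) / real (n * q) \<le> (real n * c) / real (n * q)"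
      using assms(3)[of n] by (intro divide_right_mono) auto
    also have "\<dots> = c / real q" using \<open>n \<ge> 1\<close> by simp
    finally show "((g ^^ (n * q)) x - x) / real (n * q) \<le> c / real q" .
  qed
qed

lemma funpow_mult_ge:
  fixes g :: "real \<Rightarrow> real" and p :: int
  assumes "mono g" "is_lift g" "(g ^^ q) x \<ge> x + of_int p"
  shows "(g ^^ (k * q)) x \<ge> x + real k * of_int p"
proof (induction k)
  case (Suc k)
  have "(g ^^ q) ((g ^^ (k * q)) x) \<ge> (g ^^ q) (x + of_int (int k * p))"
    using Suc by (intro funpow_mono[OF assms(1)]) simp
  then show ?case using assms(3) unfolding funpow_add_int[OF assms(2)]
    by (simp add: funpow_add algebra_simps)
qed simp

text \<open>If the displacement \<open>h\<close> had a strict sign everywhere, its extremum over a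
  period, attained by compactness, would keep the rotation number away from \<open>p / q\<close>. So
  its maximum is nonnegative, its minimum nonpositive, and it vanishes in between.\<close>

lemma periodic_point_exists:
  fixes p :: int
  assumes "mono g" "is_lift g" "continuous_on UNIV g" "q > 0"
    and rot: "has_rotation_number g (of_int p / real q)"
  obtains x where "(g ^^ q) x = x + of_int p"
proof -
  define h where "h x = (g ^^ q) x - x - of_int p" for x
  have conth: "continuous_on UNIV h"
    unfolding h_def by (intro continuous_intros continuous_on_funpow assms)
  have per: "h (x + of_int n) = h x" for x n
    unfolding h_def funpow_add_int[OF assms(2)] by simp
  have iter_le: "(g ^^ (k * q)) x \<le> x + real k * (of_int p + c)" if "\<And>x. h x \<le> c" for c x k
  proof (induction k)
    case (Suc k)
    show ?case using Suc that[of "(g ^^ (k * q)) x"] by (simp add: funpow_add h_def algebra_simps)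
  qed simp
  have iter_ge: "(g ^^ (k * q)) x \<ge> x + real k * (of_int p + c)" if "\<And>x. h x \<ge> c" for c x k
  proof (induction k)
    case (Suc k)
    show ?case using Suc that[of "(g ^^ (k * q)) x"] by (simp add: funpow_add h_def algebra_simps)
  qed simp
  obtain u where u: "u \<in> {0..1}" "\<And>x. x \<in> {0..1} \<Longrightarrow> h x \<le> h u"
    using continuous_attains_sup[of "{0..1::real}" h] continuous_on_subset[OF conth] by auto
  obtain v where v: "v \<in> {0..1}" "\<And>x. x \<in> {0..1} \<Longrightarrow> h v \<le> h x"
    using continuous_attains_inf[of "{0..1::real}" h] continuous_on_subset[OF conth] by auto
  have bounds: "h v \<le> h x \<and> h x \<le> h u" for x
  proof -
    obtain n where "0 \<le> x + of_int n" "x + of_int n < 1" by (rule lift_fundamental_domain)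
    then show ?thesis using u(2)[of "x + of_int n"] v(2)[of "x + of_int n"] by (auto simp: per)
  qed
  have "of_int p / real q \<le> (of_int p + h u) / real q"
    using bounds by (intro rotation_number_le[OF rot assms(4), of 0] iter_le) auto
  then have hu: "h u \<ge> 0" using assms(4) by (simp add: field_simps)
  have "of_int p / real q \<ge> (of_int p + h v) / real q"
    using bounds by (intro rotation_number_ge[OF rot assms(4), of 0] iter_ge) auto
  then have hv: "h v \<le> 0" using assms(4) by (simp add: divide_le_cancel)
  have "\<exists>x. h x = 0"
  proof (cases "u \<le> v")
    case True
    then show ?thesis using IVT2'[of h v 0 u] hu hv continuous_on_subset[OF conth] by auto
  next
    case False
    then show ?thesis using IVT'[of h v 0 u] hu hv continuous_on_subset[OF conth] by auto
  qed
  then obtain x where "h x = 0" ..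
  then show ?thesis by (intro that[of x]) (simp add: h_def)
qed

section \<open>The lower and upper monotone bounds\<close>

text \<open>Conjugation by \<open>x \<mapsto> - x\<close>. It exchanges the two monotone bounds and
  changes the sign of rotation numbers, so each fact on the upper bound is obtained from one on the
  lower bound.\<close>

definition reflect :: "(real \<Rightarrow> real) \<Rightarrow> real \<Rightarrow> real" where
  "reflect f x = - f (- x)"

lemma reflect_reflect [simp]: "reflect (reflect f) = f"
  by (simp add: reflect_def fun_eq_iff)

lemma funpow_reflect: "(reflect f ^^ i) x = - (f ^^ i) (- x)"
  by (induction i) (auto simp: reflect_def)

lemma degree_one_lift_iff: "degree_one_lift f \<longleftrightarrow> is_lift f \<and> continuous_on UNIV f"
  by (auto simp: degree_one_lift_def is_lift_def)

lemma is_lift_reflect: "is_lift f \<Longrightarrow> is_lift (reflect f)"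
  using lift_add_int[of f _ "-1"] by (auto simp: is_lift_def reflect_def)

lemma degree_one_lift_reflect: "degree_one_lift f \<Longrightarrow> degree_one_lift (reflect f)"
  unfolding degree_one_lift_iff
  by (auto simp: reflect_def[abs_def] is_lift_reflect[unfolded reflect_def[abs_def]]
      intro!: continuous_intros continuous_on_compose2[of UNIV f])

lemma mono_reflect: "mono f \<Longrightarrow> mono (reflect f)"
  by (auto simp: mono_def reflect_def)

lemma upper_bound_eq_reflect: "upper_bound f = reflect (lower_bound (reflect f))"
proof
  fix x
  have "upper_bound f x = - Inf (uminus ` f ` {..x})"
    by (simp add: upper_bound_def Inf_real_def image_image)
  also have "uminus ` f ` {..x} = reflect f ` {-x..}"
  proof (intro equalityI subsetI)
    fix y assume "y \<in> uminus ` f ` {..x}"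
    then obtain t where "t \<le> x" "y = - f t" by auto
    then show "y \<in> reflect f ` {- x..}" by (intro image_eqI[of _ _ "- t"]) (auto simp: reflect_def)
  qed (auto simp: reflect_def)
  finally show "upper_bound f x = reflect (lower_bound (reflect f)) x"
    by (simp add: lower_bound_def reflect_def)
qed

lemma lower_bound_eq:
  assumes "\<And>y. y \<ge> x \<Longrightarrow> f y \<ge> v" "z \<ge> x" "f z = v"
  shows "lower_bound f x = v"
  unfolding lower_bound_def using assms by (intro cInf_eq_minimum) auto

context
  fixes f :: "real \<Rightarrow> real"
  assumes f: "degree_one_lift f"
begin

lemma lower_bound_bdd: "bdd_below (f ` {x..})"
proof -
  obtain M where M: "\<And>x. \<bar>f x - x\<bar> \<le> M"
    using lift_displacement_bounded f unfolding degree_one_lift_iff by metis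
  have "f y \<ge> x - M" if "y \<ge> x" for y using M[of y] that by linarith
  then show ?thesis by (auto simp: bdd_below_def)
qed

lemma lower_bound_le: "x \<le> y \<Longrightarrow> lower_bound f x \<le> f y"
  unfolding lower_bound_def by (intro cINF_lower lower_bound_bdd) auto

lemma mono_lower_bound: "mono (lower_bound f)"
  unfolding lower_bound_def
  by (intro monoI cInf_superset_mono lower_bound_bdd image_mono) auto

text \<open>Take the last \<open>x\<close> with \<open>f x \<le> y\<close>: beyond it
  \<open>f\<close> stays above \<open>y\<close>, so \<open>f\<close> touches its lower bound there.
  The points of contact thus map onto the whole line, which yields the continuity of the bound and
  the backward orbits used below.\<close>

lemma lower_bound_surj:
  obtains x where "f x = y" "lower_bound f x = y"
proof -
  obtain M where M: "\<And>x. \<bar>f x - x\<bar> \<le> M"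
    using lift_displacement_bounded f unfolding degree_one_lift_iff by metis
  have cont: "continuous_on UNIV f" using f by (simp add: degree_one_lift_def)
  define S where "S = {t. f t \<le> y}"
  have "f (y - M) \<le> y" using M[of "y - M"] by linarith
  then have ne: "S \<noteq> {}" by (auto simp: S_def)
  have bdd: "bdd_above S"
    unfolding bdd_above_def
  proof (intro exI ballI)
    fix t assume "t \<in> S" then show "t \<le> y + M" using M[of t] by (simp add: S_def)
  qed
  have "closed S" unfolding S_def by (intro closed_Collect_le cont continuous_intros)
  define x where "x = Sup S"
  have "x \<in> S" unfolding x_def by (rule closed_contains_Sup[OF ne bdd \<open>closed S\<close>])
  have above: "f u > y" if "u > x" for u
  proof (rule ccontr)
    assume "\<not> f u > y"
    then have "u \<in> S" by (simp add: S_def)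
    then show False using cSup_upper[OF _ bdd] that by (force simp: x_def)
  qed
  have "f x \<ge> y"
  proof (rule ccontr)
    assume "\<not> f x \<ge> y"
    then have lt: "f x < y" by simp
    have "x < max (x + 1) (y + M)" by linarith
    from above[OF this] have "f (max (x + 1) (y + M)) \<ge> y" by simp
    then have "\<exists>t\<ge>x. t \<le> max (x + 1) (y + M) \<and> f t = y"
      using lt by (intro IVT') (auto intro: continuous_on_subset[OF cont])
    then obtain t where "t \<ge> x" "f t = y" by blast
    then show False using above[of t] lt by (cases "t = x") auto
  qed
  then have fx: "f x = y" using \<open>x \<in> S\<close> by (auto simp: S_def)
  moreover have "lower_bound f x = y"
    using above fx by (intro lower_bound_eq[of _ _ _ x]) (auto simp: le_less)
  ultimately show ?thesis by (rule that)
qed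

text \<open>A monotone function can fail to be continuous only by skipping values, and this one is
  onto.\<close>

lemma continuous_on_lower_bound: "continuous_on UNIV (lower_bound f)"
proof (rule continuous_onI_mono)
  have "range (lower_bound f) = UNIV"
    by (metis lower_bound_surj surj_def)
  then show "open (range (lower_bound f))" by simp
qed (use mono_lower_bound in \<open>auto dest: monoD\<close>)

lemma is_lift_lower_bound: "is_lift (lower_bound f)"
  unfolding is_lift_def
proof
  fix x :: real
  have lift: "f (y + 1) = f y + 1" for y using f by (simp add: degree_one_lift_def)
  have ge: "c \<le> lower_bound f u" if "\<And>y. y \<ge> u \<Longrightarrow> c \<le> f y" for c u
    unfolding lower_bound_def using that by (intro cINF_greatest) auto
  have "lower_bound f (x + 1) - 1 \<le> f y" if "y \<ge> x" for y
    using lower_bound_le[of "x + 1" "y + 1"] that by (simp add: lift)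
  then have "lower_bound f (x + 1) - 1 \<le> lower_bound f x" by (rule ge)
  moreover have "lower_bound f x + 1 \<le> f y" if "y \<ge> x + 1" for y
    using lower_bound_le[of x "y - 1"] lift[of "y - 1"] that by simp
  then have "lower_bound f x + 1 \<le> lower_bound f (x + 1)" by (rule ge)
  ultimately show "lower_bound f (x + 1) = lower_bound f x + 1" by simp
qed

text \<open>A backward orbit along points where the two maps agree exists by surjectivity; compactness
  turns it into a forward one.\<close>

lemma lower_bound_common_orbit:
  obtains z where "\<And>m. (f ^^ m) z = (lower_bound f ^^ m) z"
proof -
  let ?g = "lower_bound f"
  define E where "E n = {x \<in> {0..1}. \<forall>i\<le>n. f ((?g ^^ i) x) = ?g ((?g ^^ i) x)}" for n :: nat
  have cont: "continuous_on UNIV f" and lift: "is_lift f"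
    using f by (auto simp: degree_one_lift_iff)
  have cE: "compact (E n)" for n
  proof -
    have "closed {x. \<forall>i\<le>n. f ((?g ^^ i) x) = ?g ((?g ^^ i) x)}"
      by (intro closed_Collect_all closed_Collect_imp closed_Collect_eq open_Collect_const
          continuous_on_compose2[OF cont] continuous_on_compose2[OF continuous_on_lower_bound]
          continuous_on_funpow continuous_on_lower_bound) auto
    moreover have "E n = {0..1} \<inter> {x. \<forall>i\<le>n. f ((?g ^^ i) x) = ?g ((?g ^^ i) x)}"
      by (auto simp: E_def)
    ultimately show ?thesis by (simp add: compact_Int_closed)
  qed
  have backward: "\<exists>x. (?g ^^ Suc n) x = y \<and> (\<forall>i\<le>n. f ((?g ^^ i) x) = ?g ((?g ^^ i) x))" for n y
  proof (induction n arbitrary: y)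
    case 0
    then show ?case by (metis funpow_0 funpow_Suc_right comp_apply le_zero_eq lower_bound_surj)
  next
    case (Suc n)
    obtain w where w: "f w = y" "?g w = y" by (rule lower_bound_surj)
    obtain x where x: "(?g ^^ Suc n) x = w" "\<forall>i\<le>n. f ((?g ^^ i) x) = ?g ((?g ^^ i) x)"
      using Suc by blast
    have "(?g ^^ Suc (Suc n)) x = y" using x w by simp
    moreover have "\<forall>i\<le>Suc n. f ((?g ^^ i) x) = ?g ((?g ^^ i) x)"
      using x w by (auto simp: le_Suc_eq)
    ultimately show ?case by blast
  qed
  have neE: "E n \<noteq> {}" for n
  proof -
    obtain x where x: "\<forall>i\<le>n. f ((?g ^^ i) x) = ?g ((?g ^^ i) x)" using backward[of n 0] by blast
    obtain k where k: "0 \<le> x + of_int k" "x + of_int k < 1" by (rule lift_fundamental_domain)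
    have "x + of_int k \<in> E n"
      using x k by (auto simp: E_def funpow_add_int is_lift_lower_bound lift_add_int lift)
    then show ?thesis by blast
  qed
  have "\<Inter> (range E) \<noteq> {}"
    by (rule compact_nest[OF cE neE]) (auto simp: E_def)
  then obtain z where z: "z \<in> E n" for n by blast
  have "(f ^^ m) z = (?g ^^ m) z" for m
  proof (induction m)
    case (Suc m)
    then show ?case using z[of m] by (simp add: E_def)
  qed simp
  then show ?thesis by (rule that)
qed

text \<open>The common orbit puts the rotation number of the bound into
  \<open>Rot f\<close>.\<close>

lemma Rot_lower_bound:
  assumes "Rot f = {\<omega>}"
  shows "has_rotation_number (lower_bound f) \<omega>"
proof -
  obtain \<rho> where \<rho>: "has_rotation_number (lower_bound f) \<rho>"
    using mono_lift_has_rotation_number mono_lower_bound is_lift_lower_bound by blast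
  obtain z where z: "\<And>m. (f ^^ m) z = (lower_bound f ^^ m) z"
    using lower_bound_common_orbit by blast
  have "\<rho> \<in> Rot f"
  proof -
    have "(\<lambda>m. ((f ^^ m) z - z) / real m) \<longlonglongrightarrow> \<rho>"
      using \<rho> unfolding z by (simp add: has_rotation_number_def)
    then show ?thesis by (auto simp: Rot_def)
  qed
  then show ?thesis using assms \<rho> by simp
qed

end

section \<open>Rotation numbers and rotation sets under reflection\<close>

lemma has_rotation_number_reflect:
  assumes "has_rotation_number g \<rho>"
  shows "has_rotation_number (reflect g) (- \<rho>)"
  unfolding has_rotation_number_def
proof
  fix x
  have "(\<lambda>m. - (((g ^^ m) (- x) - (- x)) / real m)) \<longlonglongrightarrow> - \<rho>"
    using assms by (intro tendsto_minus) (simp only: has_rotation_number_def)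
  then show "(\<lambda>m. ((reflect g ^^ m) x - x) / real m) \<longlonglongrightarrow> - \<rho>"
    unfolding funpow_reflect minus_divide_left by simp
qed

lemma Rot_reflect_subset: "\<rho> \<in> Rot f \<Longrightarrow> - \<rho> \<in> Rot (reflect f)"
proof -
  assume "\<rho> \<in> Rot f"
  then obtain x where "(\<lambda>m. ((f ^^ m) x - x) / real m) \<longlonglongrightarrow> \<rho>" by (auto simp: Rot_def)
  then have "(\<lambda>m. - (((f ^^ m) x - x) / real m)) \<longlonglongrightarrow> - \<rho>" by (rule tendsto_minus)
  then have "(\<lambda>m. ((reflect f ^^ m) (- x) - (- x)) / real m) \<longlonglongrightarrow> - \<rho>"
    unfolding funpow_reflect minus_divide_left by simp
  then show ?thesis unfolding Rot_def by blast
qed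

lemma Rot_reflect: "Rot (reflect f) = {- \<omega>} \<longleftrightarrow> Rot f = {\<omega>}"
proof -
  have "\<rho> \<in> Rot (reflect f) \<longleftrightarrow> - \<rho> \<in> Rot f" for \<rho>
    using Rot_reflect_subset[of \<rho> "reflect f"] Rot_reflect_subset[of "- \<rho>" f] by auto
  then show ?thesis unfolding set_eq_iff by (metis minus_equation_iff singleton_iff)
qed

section \<open>Rotation sets at a tip\<close>

lemma le_upper_bound:
  assumes "degree_one_lift f" "y \<le> x"
  shows "f y \<le> upper_bound f x"
  using lower_bound_le[OF degree_one_lift_reflect[OF assms(1)], of "- x" "- y"] assms(2)
  by (simp add: upper_bound_eq_reflect reflect_def)

lemma mono_upper_bound: "degree_one_lift f \<Longrightarrow> mono (upper_bound f)"
  unfolding upper_bound_eq_reflect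
  by (intro mono_reflect mono_lower_bound degree_one_lift_reflect)

lemma degree_one_lift_lower_bound: "degree_one_lift f \<Longrightarrow> degree_one_lift (lower_bound f)"
  by (simp add: degree_one_lift_iff continuous_on_lower_bound is_lift_lower_bound)

lemma degree_one_lift_upper_bound: "degree_one_lift f \<Longrightarrow> degree_one_lift (upper_bound f)"
  unfolding upper_bound_eq_reflect
  by (intro degree_one_lift_lower_bound degree_one_lift_reflect)

lemma Rot_upper_bound:
  assumes "degree_one_lift f" "Rot f = {\<omega>}"
  shows "has_rotation_number (upper_bound f) \<omega>"
  using has_rotation_number_reflect[OF Rot_lower_bound[OF degree_one_lift_reflect[OF assms(1)]], of "- \<omega>"]
  by (simp add: upper_bound_eq_reflect Rot_reflect assms(2))

lemma Rot_eq_singleton: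
  assumes "has_rotation_number f \<omega>"
  shows "Rot f = {\<omega>}"
  using assms LIMSEQ_unique unfolding Rot_def has_rotation_number_def by blast

lemma has_rotation_number_sandwich:
  assumes "has_rotation_number g \<omega>" "has_rotation_number h \<omega>"
    and "\<And>m x. (g ^^ m) x \<le> (f ^^ m) x" "\<And>m x. (f ^^ m) x \<le> (h ^^ m) x"
  shows "has_rotation_number f \<omega>"
  unfolding has_rotation_number_def
proof
  fix x
  show "(\<lambda>m. ((f ^^ m) x - x) / real m) \<longlonglongrightarrow> \<omega>"
  proof (rule real_tendsto_sandwich)
    show "(\<lambda>m. ((g ^^ m) x - x) / real m) \<longlonglongrightarrow> \<omega>" "(\<lambda>m. ((h ^^ m) x - x) / real m) \<longlonglongrightarrow> \<omega>"
      using assms(1,2) by (auto simp: has_rotation_number_def)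
  qed (use assms(3,4) in \<open>auto intro!: always_eventually divide_right_mono\<close>)
qed

lemma has_rotation_number_mono:
  assumes "has_rotation_number g \<rho>" "has_rotation_number h \<omega>"
    and "\<And>m x. (g ^^ m) x \<le> (h ^^ m) x"
  shows "\<rho> \<le> \<omega>"
proof (rule LIMSEQ_le)
  show "(\<lambda>m. ((g ^^ m) 0 - 0) / real m) \<longlonglongrightarrow> \<rho>" "(\<lambda>m. ((h ^^ m) 0 - 0) / real m) \<longlonglongrightarrow> \<omega>"
    using assms(1,2) by (simp_all only: has_rotation_number_def)
qed (use assms(3) in \<open>auto intro!: divide_right_mono\<close>)

lemma continuous_funpow_translate:
  fixes g :: "real \<Rightarrow> real"
  assumes "continuous_on UNIV g"
  shows "continuous_on UNIV (\<lambda>c. ((\<lambda>x. g x + c) ^^ i) x)"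
proof (induction i)
  case (Suc i)
  then show ?case
    by (auto intro!: continuous_intros continuous_on_compose2[OF assms])
qed simp

text \<open>Suppose the iterate of the lower bound exceeds \<open>x + p\<close> somewhere. By
  continuity it still does after \<open>f\<close> is lowered slightly, so the rotation number of the
  lowered bound does not drop below \<open>p / q\<close>. The lowered map then still has rotation
  set \<open>{p / q}\<close>, against uniqueness.\<close>

lemma tip_lower_bound_le:
  fixes p :: int
  assumes f: "degree_one_lift f" and "q > 0"
    and rot: "Rot f = {of_int p / real q}"
    and uniq: "\<And>c. Rot (\<lambda>x. f x + c) = {of_int p / real q} \<Longrightarrow> c = 0"
  shows "(lower_bound f ^^ q) x \<le> x + of_int p"
proof (rule ccontr)
  define g where "g = lower_bound f"
  define h where "h = upper_bound f"
  let ?g = "\<lambda>c x. g x + c"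
  have g: "mono g" "is_lift g" "continuous_on UNIV g" "\<And>x. g x \<le> f x"
    using f by (auto simp: g_def mono_lower_bound is_lift_lower_bound continuous_on_lower_bound
        lower_bound_le)
  have h: "mono h" "\<And>x. f x \<le> h x"
    using f by (auto simp: h_def mono_upper_bound le_upper_bound)
  assume "\<not> (lower_bound f ^^ q) x \<le> x + of_int p"
  then have "(?g 0 ^^ q) x > x + of_int p" by (simp add: g_def)
  then have "\<forall>\<^sub>F c in at 0. (?g c ^^ q) x > x + of_int p"
    using continuous_funpow_translate[OF g(3), of q x]
    by (intro order_tendstoD(1)[where y = "(?g 0 ^^ q) x"])
      (simp_all only: continuous_on_eq_continuous_at[OF open_UNIV] isCont_def UNIV_I simp_thms)
  then obtain d where d: "d > 0" "\<And>c. c \<noteq> 0 \<Longrightarrow> \<bar>c\<bar> < d \<Longrightarrow> (?g c ^^ q) x > x + of_int p"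
    by (auto simp: eventually_at dist_real_def)
  \<comment> \<open>Negative, so that the upper bound of \<open>f\<close> still dominates the
    translated map.\<close>
  define c where "c = - d / 2"
  have c: "c < 0" "(?g c ^^ q) x \<ge> x + of_int p"
    using d(1) d(2)[of c] by (auto simp: c_def)
  have gc: "mono (?g c)" "is_lift (?g c)"
    using g by (auto simp: mono_def is_lift_def)
  obtain \<rho> where \<rho>: "has_rotation_number (?g c) \<rho>"
    using mono_lift_has_rotation_number[OF gc] .
  have "\<rho> \<ge> of_int p / real q"
    by (rule rotation_number_ge[OF \<rho> \<open>q > 0\<close> funpow_mult_ge[OF gc c(2)]])
  moreover have "\<rho> \<le> of_int p / real q"
  proof (rule has_rotation_number_mono[OF \<rho>])
    show "has_rotation_number g (of_int p / real q)"
      unfolding g_def by (rule Rot_lower_bound[OF f rot])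
    show "(?g c ^^ m) x \<le> (g ^^ m) x" for m x
      using c(1) g(1) by (intro funpow_le_funpow) auto
  qed
  ultimately have "has_rotation_number (?g c) (of_int p / real q)" using \<rho> by simp
  moreover have "has_rotation_number h (of_int p / real q)"
    unfolding h_def by (rule Rot_upper_bound[OF f rot])
  \<comment> \<open>The lowered map lies between the lowered lower bound and the original upper
    bound.\<close>
  ultimately have "has_rotation_number (\<lambda>x. f x + c) (of_int p / real q)"
  proof (rule has_rotation_number_sandwich)
    show "(?g c ^^ m) x \<le> ((\<lambda>x. f x + c) ^^ m) x" for m x
      using g(4) gc(1) by (intro funpow_le_funpow) auto
    show "((\<lambda>x. f x + c) ^^ m) x \<le> (h ^^ m) x" for m x
    proof (intro funpow_le_funpow)
      show "f x + c \<le> h x" for x using h(2)[of x] c(1) by linarith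
    qed (use h(1) in auto)
  qed
  then have "c = 0" by (intro uniq Rot_eq_singleton)
  then show False using c(1) by simp
qed

lemma tip_upper_bound_ge:
  fixes p :: int
  assumes f: "degree_one_lift f" and "q > 0"
    and rot: "Rot f = {of_int p / real q}"
    and uniq: "\<And>c. Rot (\<lambda>x. f x + c) = {of_int p / real q} \<Longrightarrow> c = 0"
  shows "(upper_bound f ^^ q) x \<ge> x + of_int p"
proof -
  have "(lower_bound (reflect f) ^^ q) (- x) \<le> - x + of_int (- p)"
  proof (rule tip_lower_bound_le[OF degree_one_lift_reflect[OF f] \<open>q > 0\<close>])
    show "Rot (reflect f) = {of_int (- p) / real q}"
      using Rot_reflect[of f "of_int p / real q"] rot by simp
    fix c assume "Rot (\<lambda>x. reflect f x + c) = {of_int (- p) / real q}"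
    moreover have "(\<lambda>x. reflect f x + c) = reflect (\<lambda>x. f x + (- c))"
      by (auto simp: reflect_def)
    ultimately have "Rot (\<lambda>x. f x + (- c)) = {of_int p / real q}"
      using Rot_reflect[of _ "of_int p / real q"] by simp
    then have "- c = 0" by (rule uniq)
    then show "c = 0" by simp
  qed
  then show ?thesis by (simp add: upper_bound_eq_reflect funpow_reflect)
qed

section \<open>Periodic points of monotone lifts\<close>

definition periodic_set :: "(real \<Rightarrow> real) \<Rightarrow> nat \<Rightarrow> int \<Rightarrow> real set" where
  "periodic_set g q p = {x. (g ^^ q) x = x + of_int p}"

text \<open>On periodic points of rotation number \<open>p / q\<close>, with \<open>q' * p - p' * q = 1\<close>, this map sends
  every point to the next one of its orbit modulo 1.\<close>

definition step_map :: "(real \<Rightarrow> real) \<Rightarrow> nat \<Rightarrow> int \<Rightarrow> real \<Rightarrow> real" where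
  "step_map g q' p' x = (g ^^ q') x - of_int p'"

lemma periodic_set_add_int:
  assumes "is_lift g" "x \<in> periodic_set g q p"
  shows "x + of_int n \<in> periodic_set g q p"
  using assms by (simp add: periodic_set_def funpow_add_int)

lemma periodic_set_funpow:
  assumes "is_lift g" "x \<in> periodic_set g q p"
  shows "(g ^^ i) x \<in> periodic_set g q p"
proof -
  have "(g ^^ q) ((g ^^ i) x) = (g ^^ i) ((g ^^ q) x)"
    by (metis add.commute comp_apply funpow_add)
  then show ?thesis using assms by (simp add: periodic_set_def funpow_add_int)
qed

lemma funpow_add_apply: "(f ^^ (m + n)) x = (f ^^ m) ((f ^^ n) x)"
  by (simp add: funpow_add)

lemma periodic_set_mult:
  assumes "is_lift g" "x \<in> periodic_set g q p"
  shows "(g ^^ (k * q)) x = x + of_int (int k * p)"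
proof (induction k)
  case (Suc k)
  have "(g ^^ (Suc k * q)) x = (g ^^ q) (x + of_int (int k * p))"
    by (simp add: funpow_add Suc)
  then show ?case
    using assms by (simp only: funpow_add_int) (simp add: periodic_set_def algebra_simps)
qed simp

lemma periodic_set_shift:
  assumes "is_lift g" "x \<in> periodic_set g q p" and ij: "int i = int j + n * int q"
  shows "(g ^^ i) x = (g ^^ j) x + of_int (n * p)"
proof (cases "n \<ge> 0")
  case True
  then have "int i = int (j + nat n * q)" using ij by simp
  then have "i = j + nat n * q" by (simp only: of_nat_eq_iff)
  then have "(g ^^ i) x = (g ^^ j) ((g ^^ (nat n * q)) x)" by (simp add: funpow_add)
  also have "\<dots> = (g ^^ j) x + of_int (n * p)"
    using True unfolding periodic_set_mult[OF assms(1,2)] funpow_add_int[OF assms(1)] by simp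
  finally show ?thesis .
next
  case False
  then have "int j = int (i + nat (- n) * q)" using ij by simp
  then have "j = i + nat (- n) * q" by (simp only: of_nat_eq_iff)
  then have "(g ^^ j) x = (g ^^ i) ((g ^^ (nat (- n) * q)) x)" by (simp add: funpow_add)
  also have "\<dots> = (g ^^ i) x - of_int (n * p)"
    using False unfolding periodic_set_mult[OF assms(1,2)] funpow_add_int[OF assms(1)] by simp
  finally show ?thesis by simp
qed

text \<open>By \<open>det\<close>, \<open>q'\<close> inverts \<open>p\<close> modulo
  \<open>q\<close>. The translation \<open>p'\<close> is an integer because it is negative for
  \<open>p = 0\<close>.\<close>

locale periodic_mono_lift =
  fixes g :: "real \<Rightarrow> real" and q :: nat and p :: int and q' :: nat and p' :: int
  assumes mono_g: "mono g" and lift_g: "is_lift g" and q_pos: "q > 0"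
    and det: "int q' * p - p' * int q = 1"
begin

abbreviation "P \<equiv> periodic_set g q p"
abbreviation "T \<equiv> step_map g q' p'"

lemma T_add_int: "T (x + of_int n) = T x + of_int n"
  unfolding step_map_def funpow_add_int[OF lift_g] by simp

lemma mono_T: "mono T"
  by (auto simp: mono_def step_map_def intro!: funpow_mono[OF mono_g])

lemma T_in_P: "x \<in> P \<Longrightarrow> T x \<in> P"
  using periodic_set_add_int[OF lift_g periodic_set_funpow[OF lift_g], of x q p q' "- p'"]
  by (simp add: step_map_def)

lemma funpow_T_in_P: "x \<in> P \<Longrightarrow> (T ^^ k) x \<in> P"
  by (induction k) (auto intro: T_in_P)

lemma funpow_T: "(T ^^ k) x = (g ^^ (k * q')) x - of_int (int k * p')"
proof (induction k)
  case (Suc k)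
  have "(T ^^ Suc k) x = T ((g ^^ (k * q')) x + of_int (- (int k * p')))"
    using Suc by simp
  also have "\<dots> = (g ^^ (Suc k * q')) x - of_int (int (Suc k) * p')"
    unfolding T_add_int by (simp add: step_map_def funpow_add algebra_simps)
  finally show ?case .
qed simp

lemma funpow_T_q:
  assumes "x \<in> P"
  shows "(T ^^ q) x = x + 1"
proof -
  have "(g ^^ (q * q')) x = x + of_int (int q' * p)"
    using periodic_set_mult[OF lift_g assms, of q'] by (simp add: mult.commute)
  then have "(T ^^ q) x = x + of_int (int q' * p - p' * int q)" by (simp add: funpow_T mult.commute)
  then show ?thesis using det by simp
qed

text \<open>Since \<open>p * q' = 1 + p' * q\<close>, the \<open>p\<close>-th iterate of
  \<open>T\<close> is one application of \<open>g\<close> up to full periods, whose translations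
  cancel.\<close>

lemma funpow_T_p:
  assumes "x \<in> P" "p = int n"
  shows "(T ^^ n) x = g x"
proof -
  have "int (n * q') = int 1 + p' * int q" using det assms(2) by (simp add: algebra_simps)
  from periodic_set_shift[OF lift_g assms(1) this]
  show ?thesis using assms(2) by (simp add: funpow_T mult.commute)
qed

lemma T_gt:
  assumes "x \<in> P"
  shows "T x > x"
proof (rule ccontr)
  assume "\<not> T x > x"
  then have le: "T x \<le> x" by simp
  have "(T ^^ k) x \<le> x" for k
  proof (induction k)
    case (Suc k)
    then show ?case using monoD[OF mono_T Suc] le by simp
  qed simp
  from this[of q] show False using funpow_T_q[OF assms] by simp
qed

lemma funpow_T_mult:
  assumes "x \<in> P"
  shows "(T ^^ (k + n * q)) x = (T ^^ k) x + real n"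
proof (induction n)
  case (Suc n)
  have "(T ^^ (k + Suc n * q)) x = (T ^^ q) ((T ^^ (k + n * q)) x)"
    unfolding funpow_add_apply[symmetric] by (simp add: add_ac)
  also have "\<dots> = (T ^^ (k + n * q)) x + 1" by (rule funpow_T_q[OF funpow_T_in_P[OF assms]])
  finally show ?case using Suc by simp
qed simp

end

text \<open>Choose \<open>y\<close> as the last point of the \<open>h\<close>-orbit strictly below
  \<open>x\<close>, so that \<open>y < x \<le> T y\<close> for the step map of \<open>h\<close>. The
  second inequality persists because the step map of \<open>g\<close> lies below that of
  \<open>h\<close>.\<close>

lemma interlacing:
  assumes l: "periodic_mono_lift g q p q' p'" and u: "periodic_mono_lift h q p q' p'"
    and le: "\<And>x. g x \<le> h x"
    and x: "x \<in> periodic_set g q p" and "y0 \<in> periodic_set h q p"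
  obtains y where "y \<in> periodic_set h q p"
    "\<And>k. (step_map h q' p' ^^ k) y < (step_map g q' p' ^^ k) x"
    "\<And>k. (step_map g q' p' ^^ k) x \<le> (step_map h q' p' ^^ Suc k) y"
proof -
  interpret l: periodic_mono_lift g q p q' p' by fact
  interpret u: periodic_mono_lift h q p q' p' by fact
  obtain n :: nat where n: "real n > y0 - x" using reals_Archimedean2 by blast
  define w where "w = y0 + of_int (- int n)"
  have w: "w \<in> u.P" "w < x"
    using n periodic_set_add_int[OF u.lift_g assms(5), of "- int n"] by (auto simp: w_def)
  obtain m :: nat where m: "real m > x - w" using reals_Archimedean2 by blast
  have ex: "(u.T ^^ (m * q)) w \<ge> x"
    using u.funpow_T_mult[OF w(1), of 0 m] m by simp
  define k0 where "k0 = (LEAST k. (u.T ^^ k) w \<ge> x)"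
  have k0: "(u.T ^^ k0) w \<ge> x" unfolding k0_def using ex by (rule LeastI)
  have "k0 \<noteq> 0" using k0 w by (intro notI) simp
  then obtain k1 where k1: "k0 = Suc k1" using not0_implies_Suc by blast
  have "\<not> (u.T ^^ k1) w \<ge> x"
    using k1 unfolding k0_def by (intro not_less_Least) simp
  then have "(u.T ^^ k1) w < x" by simp
  define y where "y = (u.T ^^ k1) w"
  have y: "y \<in> u.P" "y < x" "x \<le> u.T y"
    using \<open>(u.T ^^ k1) w < x\<close> k0 k1 by (auto simp: y_def intro: u.funpow_T_in_P w)
  have Tle: "l.T z \<le> u.T z" for z
    unfolding step_map_def using le l.mono_g by (simp add: funpow_le_funpow)
  have upper: "(l.T ^^ k) x \<le> (u.T ^^ Suc k) y" for k
  proof -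
    have "(l.T ^^ k) x \<le> (u.T ^^ k) (u.T y)"
      using Tle y(3) l.mono_T by (intro funpow_le_funpow) auto
    then show ?thesis by (simp add: funpow_Suc_right del: funpow.simps)
  qed
  \<comment> \<open>The strict inequality is not preserved step by step. But a failure at time
    \<open>k\<close> would persist up to time \<open>k * q\<close>, where both orbits have moved by
    exactly \<open>k\<close> and are again ordered as at the start.\<close>
  have lower: "(u.T ^^ k) y < (l.T ^^ k) x" for k
  proof (rule ccontr)
    assume "\<not> (u.T ^^ k) y < (l.T ^^ k) x"
    then have "(l.T ^^ k) x \<le> (u.T ^^ k) y" by simp
    then have "(l.T ^^ (k * q - k)) ((l.T ^^ k) x) \<le> (u.T ^^ (k * q - k)) ((u.T ^^ k) y)"
      using Tle l.mono_T \<open>(l.T ^^ k) x \<le> (u.T ^^ k) y\<close>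
      by (intro funpow_le_funpow[of l.T u.T "(l.T ^^ k) x" "(u.T ^^ k) y"]) auto
    moreover have "k * q - k + k = 0 + k * q" using u.q_pos by (cases q) auto
    ultimately have "(l.T ^^ (0 + k * q)) x \<le> (u.T ^^ (0 + k * q)) y"
      unfolding funpow_add_apply[symmetric] by simp
    then show False
      using l.funpow_T_mult[OF x, of 0 k] u.funpow_T_mult[OF y(1), of 0 k] y(2) by simp
  qed
  show ?thesis by (rule that[OF y(1) lower upper])
qed

section \<open>Negative Schwarzian derivative\<close>

lemma C3_DERIV:
  assumes "C3 f"
  shows "(f has_real_derivative deriv f x) (at x)"
    and "(deriv f has_real_derivative (deriv ^^ 2) f x) (at x)"
    and "((deriv ^^ 2) f has_real_derivative (deriv ^^ 3) f x) (at x)"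
proof -
  have d: "((deriv ^^ k) f has_real_derivative deriv ((deriv ^^ k) f) x) (at x)" if "k < 3" for k
    using assms that by (auto simp: C3_def DERIV_deriv_iff_real_differentiable)
  show "(f has_real_derivative deriv f x) (at x)" using d[of 0] by simp
  show "(deriv f has_real_derivative (deriv ^^ 2) f x) (at x)"
    using d[of 1] by (simp add: numeral_2_eq_2)
  show "((deriv ^^ 2) f has_real_derivative (deriv ^^ 3) f x) (at x)"
    using d[of 2] by (simp add: numeral_3_eq_3 numeral_2_eq_2)
qed

lemma C3_continuous: "C3 f \<Longrightarrow> continuous_on UNIV f" "C3 f \<Longrightarrow> continuous_on UNIV (deriv f)"
  by (metis C3_DERIV(1) DERIV_continuous_on has_field_derivative_at_within)
    (metis C3_DERIV(2) DERIV_continuous_on has_field_derivative_at_within)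

lemma deriv_add_int:
  assumes "is_lift f" "C3 f"
  shows "deriv f (x + of_int n) = deriv f x"
proof (rule DERIV_unique)
  have "((\<lambda>t. f (t + of_int n)) has_real_derivative deriv f (x + of_int n)) (at x)"
    by (simp add: C3_DERIV(1)[OF assms(2)] flip: DERIV_shift)
  then have "((\<lambda>t. f (t + of_int n) - of_int n) has_real_derivative deriv f (x + of_int n)) (at x)"
    by (auto intro!: derivative_eq_intros)
  then show "(f has_real_derivative deriv f (x + of_int n)) (at x)"
    unfolding lift_add_int[OF assms(1)] by simp
qed (rule C3_DERIV(1)[OF assms(2)])

lemma nonneg_on_closed_interval:
  fixes g :: "real \<Rightarrow> real"
  assumes "continuous_on UNIV g" "s < t" "\<And>r. s < r \<Longrightarrow> r < t \<Longrightarrow> g r > 0" "s \<le> r" "r \<le> t"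
  shows "g r \<ge> 0"
proof (rule continuous_ge_on_closure[of "{s<..<t}" g])
  show "continuous_on (closure {s<..<t}) g" by (rule continuous_on_subset[OF assms(1)]) simp
  show "r \<in> closure {s<..<t}" using assms by simp
  show "0 \<le> g x" if "x \<in> {s<..<t}" for x using assms(3)[of x] that by simp
qed

definition negative_schwarzian :: "(real \<Rightarrow> real) \<Rightarrow> bool" where
  "negative_schwarzian f \<longleftrightarrow> C3 f \<and> (\<forall>x. deriv f x \<noteq> 0 \<longrightarrow> schwarzian f x < 0)"

text \<open>A negative Schwarzian derivative makes \<open>1 / sqrt (deriv f)\<close> strictly convex; integrating the
  comparison with its chord gives the inequality. Unlike the pointwise condition it passes to
  iterates without any computation of higher derivatives.\<close>

lemma schwarzian_two_point:
  assumes ns: "negative_schwarzian f" and st: "s < t"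
    and pos: "\<And>r. s < r \<Longrightarrow> r < t \<Longrightarrow> deriv f r > 0"
  shows "f s < f t" "deriv f s * deriv f t * (t - s)\<^sup>2 < (f t - f s)\<^sup>2"
proof -
  have C: "C3 f" and S: "\<And>x. deriv f x \<noteq> 0 \<Longrightarrow> schwarzian f x < 0"
    using ns by (auto simp: negative_schwarzian_def)
  note D = C3_DERIV[OF C]
  show less: "f s < f t"
  proof -
    obtain \<xi> where "\<xi> > s" "\<xi> < t" "f t - f s = (t - s) * deriv f \<xi>"
      using MVT2[OF st, of f "deriv f"] D(1) by blast
    moreover have "(t - s) * deriv f \<xi> > 0"
      using calculation(1,2) st by (intro mult_pos_pos pos) auto
    ultimately show ?thesis by simp
  qed
  have ge0: "deriv f r \<ge> 0" if "r \<in> {s..t}" for r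
    using that by (intro nonneg_on_closed_interval[OF C3_continuous(2)[OF C] st pos]) auto
  show "deriv f s * deriv f t * (t - s)\<^sup>2 < (f t - f s)\<^sup>2"
  proof (cases "deriv f s = 0 \<or> deriv f t = 0")
    case True
    then show ?thesis using less by auto
  next
    case False
    have posc: "deriv f r > 0" if "r \<in> {s..t}" for r
    proof (cases "r = s \<or> r = t")
      case True
      then have "deriv f r \<noteq> 0" using \<open>\<not> (deriv f s = 0 \<or> deriv f t = 0)\<close> by blast
      then show ?thesis using ge0[OF that] by linarith
    next
      case False
      then show ?thesis using that by (intro pos) auto
    qed
    define R where "R x = sqrt (deriv f x)" for x
    define \<phi> where "\<phi> x = 1 / R x" for x
    define \<phi>1 where "\<phi>1 x = - (deriv ^^ 2) f x / (2 * R x ^ 3)" for x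
    have Rpos: "R x > 0" "R x ^ 2 = deriv f x" if "x \<in> {s..t}" for x
      using posc[OF that] by (auto simp: R_def)
    have dR: "(R has_real_derivative (deriv ^^ 2) f x / (2 * R x)) (at x)" if "x \<in> {s..t}" for x
      unfolding R_def[abs_def] using posc[OF that]
      by (auto intro!: derivative_eq_intros D(2) simp: field_simps)
    have d\<phi>: "(\<phi> has_real_derivative \<phi>1 x) (at x)" if "x \<in> {s..t}" for x
      unfolding \<phi>_def[abs_def] \<phi>1_def using Rpos[OF that]
      by (auto intro!: derivative_eq_intros dR that simp: field_simps power2_eq_square power3_eq_cube)
    have d\<phi>1: "(\<phi>1 has_real_derivative - schwarzian f x / (2 * R x)) (at x)" if "x \<in> {s..t}" for x
    proof -
      have "(\<phi>1 has_real_derivative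
          - ((deriv ^^ 3) f x * (2 * R x ^ 3) -
              (deriv ^^ 2) f x * (2 * (3 * R x ^ 2 * ((deriv ^^ 2) f x / (2 * R x)))))
            / (2 * R x ^ 3)\<^sup>2) (at x)"
        unfolding \<phi>1_def[abs_def] using Rpos[OF that]
        by (auto intro!: derivative_eq_intros dR D(3) that
            simp: power2_eq_square power3_eq_cube divide_simps)
      moreover have "- ((deriv ^^ 3) f x * (2 * R x ^ 3) -
              (deriv ^^ 2) f x * (2 * (3 * R x ^ 2 * ((deriv ^^ 2) f x / (2 * R x)))))
            / (2 * R x ^ 3)\<^sup>2 = - schwarzian f x / (2 * R x)"
        unfolding schwarzian_def Rpos(2)[OF that, symmetric] using Rpos(1)[OF that]
        by (simp add: power2_eq_square power3_eq_cube divide_simps) (simp add: algebra_simps)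
      ultimately show ?thesis by simp
    qed
    have \<phi>1_mono: "\<phi>1 x < \<phi>1 y" if "s \<le> x" "x < y" "y \<le> t" for x y
    proof (rule DERIV_pos_imp_increasing[OF that(2)])
      fix z assume z: "x \<le> z" "z \<le> y"
      then have "z \<in> {s..t}" using that by auto
      then show "\<exists>w. (\<phi>1 has_real_derivative w) (at z) \<and> 0 < w"
        using d\<phi>1[of z] S[of z] posc[of z] Rpos[of z]
        by (intro exI[of _ "- schwarzian f z / (2 * R z)"]) (auto intro!: divide_neg_pos simp: divide_less_0_iff)
    qed
    define m where "m = (\<phi> t - \<phi> s) / (t - s)"
    define l where "l x = \<phi> s + m * (x - s)" for x
    have lt: "l s = \<phi> s" "l t = \<phi> t" using st by (auto simp: l_def m_def)
    have chord: "\<phi> x < l x" if sx: "s < x" and xt: "x < t" for x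
    proof -
      obtain a where a: "s < a" "a < x" "\<phi> x - \<phi> s = (x - s) * \<phi>1 a"
        using MVT2[OF sx, of \<phi> \<phi>1] d\<phi> xt by force
      obtain b where b: "x < b" "b < t" "\<phi> t - \<phi> x = (t - x) * \<phi>1 b"
        using MVT2[OF xt, of \<phi> \<phi>1] d\<phi> sx by force
      have "\<phi>1 a < \<phi>1 b" using a b by (intro \<phi>1_mono) auto
      then have "(t - x) * \<phi>1 a < (t - x) * \<phi>1 b" using sx xt by simp
      then have "(t - s) * \<phi>1 a < \<phi> t - \<phi> s" using a(3) b(3) by (simp add: algebra_simps)
      then have "\<phi>1 a < m" using st by (simp add: m_def field_simps)
      then have "(x - s) * \<phi>1 a < (x - s) * m" using sx xt by simp
      then show ?thesis using a(3) by (simp add: l_def algebra_simps)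
    qed
    have \<phi>pos: "\<phi> x > 0" if "x \<in> {s..t}" for x using Rpos[OF that] by (simp add: \<phi>_def)
    have lpos: "l x > 0" if "x \<in> {s..t}" for x
    proof (cases "x = s \<or> x = t")
      case True
      then show ?thesis using \<phi>pos[OF that] lt by auto
    next
      case False
      then have "s < x" "x < t" using that by auto
      then show ?thesis using chord[of x] \<phi>pos[OF that] by simp
    qed
    \<comment> \<open>The subtracted Moebius function is the primitive of
      \<open>1 / l\<^sup>2\<close> that vanishes at \<open>s\<close>; at \<open>t\<close> it equals
      \<open>(t - s) / (\<phi> s * \<phi> t)\<close>. As \<open>\<phi> < l\<close> inside,
      \<open>deriv f = 1 / \<phi>\<^sup>2\<close> exceeds its derivative.\<close>
    define \<psi> where "\<psi> x = f x - (x - s) / (\<phi> s * l x)" for x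
    have d\<psi>: "(\<psi> has_real_derivative deriv f x - 1 / (l x)\<^sup>2) (at x)" if "x \<in> {s..t}" for x
    proof -
      have dl: "(l has_real_derivative m) (at x)"
        unfolding l_def[abs_def] by (auto intro!: derivative_eq_intros)
      have s: "\<phi> s \<noteq> 0" "l x \<noteq> 0" using \<phi>pos[of s] lpos[OF that] st by auto
      have "(\<psi> has_real_derivative deriv f x -
          (1 * (\<phi> s * l x) - (x - s) * (\<phi> s * m)) / ((\<phi> s * l x) * (\<phi> s * l x))) (at x)"
        unfolding \<psi>_def[abs_def] using s
        by (auto intro!: derivative_eq_intros dl D(1))
      moreover have "1 * (\<phi> s * l x) - (x - s) * (\<phi> s * m) = \<phi> s * \<phi> s"
        by (simp add: l_def algebra_simps)
      ultimately show ?thesis using s by (simp add: power2_eq_square)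
    qed
    obtain \<xi> where \<xi>: "s < \<xi>" "\<xi> < t" "\<psi> t - \<psi> s = (t - s) * (deriv f \<xi> - 1 / (l \<xi>)\<^sup>2)"
      using MVT2[OF st, of \<psi> "\<lambda>x. deriv f x - 1 / (l x)\<^sup>2"] d\<psi> by auto
    have "deriv f \<xi> = 1 / (\<phi> \<xi>)\<^sup>2"
      using Rpos[of \<xi>] \<xi> by (simp add: \<phi>_def power_divide)
    also have "\<dots> > 1 / (l \<xi>)\<^sup>2"
      using chord[of \<xi>] \<phi>pos[of \<xi>] \<xi> by (intro divide_strict_left_mono power_strict_mono) auto
    finally have "\<psi> t - \<psi> s > 0" using \<xi> st by simp
    then have "f t - f s > (t - s) / (\<phi> s * \<phi> t)" by (simp add: \<psi>_def lt)
    then have "f t - f s > (t - s) * R s * R t" by (simp add: \<phi>_def)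
    then have "((t - s) * R s * R t)\<^sup>2 < (f t - f s)\<^sup>2"
      using st Rpos[of s] Rpos[of t] by (intro power_strict_mono) auto
    moreover have "((t - s) * R s * R t)\<^sup>2 = deriv f s * deriv f t * (t - s)\<^sup>2"
      using Rpos(2)[of s] Rpos(2)[of t] st unfolding power_mult_distrib by simp
    ultimately show ?thesis by simp
  qed
qed

section \<open>Negative Schwarzian derivative along orbits\<close>

lemma DERIV_funpow:
  assumes "\<And>x. (f has_real_derivative deriv f x) (at x)"
  shows "((f ^^ i) has_real_derivative (\<Prod>j<i. deriv f ((f ^^ j) x))) (at x)"
proof (induction i)
  case (Suc i)
  have "((\<lambda>x. f ((f ^^ i) x)) has_real_derivative deriv f ((f ^^ i) x) * (\<Prod>j<i. deriv f ((f ^^ j) x))) (at x)"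
    by (rule DERIV_chain2[OF assms Suc])
  then show ?case by (simp add: comp_def mult.commute)
qed (simp add: id_def)

text \<open>The quotient of \<open>deriv f s * deriv f t * (t - s)\<^sup>2\<close> by
  \<open>(f t - f s)\<^sup>2\<close> is multiplicative under composition, and each factor is below
  1.\<close>

lemma schwarzian_two_point_funpow:
  assumes ns: "negative_schwarzian f" and uv: "u < v" and "q > 0"
    and pos: "\<And>j r. j < q \<Longrightarrow> (f ^^ j) u < r \<Longrightarrow> r < (f ^^ j) v \<Longrightarrow> deriv f r > 0"
  shows "(\<Prod>j<q. deriv f ((f ^^ j) u)) * (\<Prod>j<q. deriv f ((f ^^ j) v)) * (v - u)\<^sup>2
    < ((f ^^ q) v - (f ^^ q) u)\<^sup>2"
proof -
  define A where "A i = (\<Prod>j<i. deriv f ((f ^^ j) u)) * (\<Prod>j<i. deriv f ((f ^^ j) v))" for i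
  \<comment> \<open>At \<open>i = 0\<close> there is equality, so the weak inequality is carried
    along and the strict one starts at \<open>i = 1\<close>.\<close>
  have *: "(f ^^ i) u < (f ^^ i) v \<and> A i * (v - u)\<^sup>2 \<le> ((f ^^ i) v - (f ^^ i) u)\<^sup>2 \<and>
      (i > 0 \<longrightarrow> A i * (v - u)\<^sup>2 < ((f ^^ i) v - (f ^^ i) u)\<^sup>2)" if "i \<le> q" for i
    using that
  proof (induction i)
    case 0
    then show ?case using uv by (simp add: A_def)
  next
    case (Suc i)
    let ?u = "(f ^^ i) u" and ?v = "(f ^^ i) v"
    have IH: "?u < ?v" "A i * (v - u)\<^sup>2 \<le> (?v - ?u)\<^sup>2" using Suc by auto
    have pos': "\<And>r. ?u < r \<Longrightarrow> r < ?v \<Longrightarrow> deriv f r > 0" using pos[of i] Suc by auto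
    note two = schwarzian_two_point[OF ns IH(1) pos']
    have cont: "continuous_on UNIV (deriv f)"
      using ns C3_continuous(2) by (simp add: negative_schwarzian_def)
    have ge0: "deriv f r \<ge> 0" if "r \<in> {?u..?v}" for r
      using that by (intro nonneg_on_closed_interval[OF cont IH(1) pos']) auto
    have "A (Suc i) * (v - u)\<^sup>2 = (deriv f ?u * deriv f ?v) * (A i * (v - u)\<^sup>2)"
      by (simp add: A_def algebra_simps)
    also have "\<dots> \<le> (deriv f ?u * deriv f ?v) * (?v - ?u)\<^sup>2"
      using ge0 IH by (intro mult_left_mono) auto
    also have "\<dots> < (f ?v - f ?u)\<^sup>2" using two(2) by simp
    finally show ?case using two(1) by simp
  qed
  then show ?thesis using \<open>q > 0\<close> by (auto simp: A_def)
qed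

text \<open>Where \<open>f\<close> touches a monotone minorant it cannot descend to the right. The
  minorant will be the lower bound, or \<open>f\<close> itself on the critical line.\<close>

lemma deriv_nonneg_of_mono_minorant:
  fixes f g :: "real \<Rightarrow> real"
  assumes "mono g" "\<And>x. g x \<le> f x" "f r = g r" "(f has_real_derivative D) (at r)"
  shows "D \<ge> 0"
proof (rule ccontr)
  assume "\<not> D \<ge> 0"
  then obtain d where d: "d > 0" "\<And>h. 0 < h \<Longrightarrow> h < d \<Longrightarrow> f (r + h) < f r"
    using DERIV_neg_dec_right[OF assms(4)] by auto
  have "f (r + d / 2) < f r" using d by auto
  moreover have "g r \<le> g (r + d / 2)" using d by (intro monoD[OF assms(1)]) auto
  ultimately show False using assms(2)[of "r + d / 2"] assms(3) by linarith
qed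

text \<open>The derivatives along the orbit have product 1, so none vanishes, and contact with the
  minorant makes them positive. The two-point inequality then reads
  \<open>(b - a)\<^sup>2 < (b - a)\<^sup>2\<close>.\<close>

lemma no_translation_iterate:
  assumes ns: "negative_schwarzian f" and "q > 0" "u < v"
    and g: "mono g" "\<And>x. g x \<le> f x"
    and agree: "\<And>t i. u < t \<Longrightarrow> t < v \<Longrightarrow> i \<le> q \<Longrightarrow> (g ^^ i) t = (f ^^ i) t"
    and transl: "\<And>t. u < t \<Longrightarrow> t < v \<Longrightarrow> (f ^^ q) t = t + c"
  shows False
proof -
  have "C3 f" using ns by (simp add: negative_schwarzian_def)
  note D = C3_DERIV(1)[OF this]
  have prod: "(\<Prod>j<q. deriv f ((f ^^ j) t)) = 1" if "u < t" "t < v" for t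
  proof (rule DERIV_unique)
    show "((f ^^ q) has_real_derivative (\<Prod>j<q. deriv f ((f ^^ j) t))) (at t)"
      by (rule DERIV_funpow[OF D])
    have "((\<lambda>t. t + c) has_real_derivative 1) (at t)" by (auto intro!: derivative_eq_intros)
    then show "((f ^^ q) has_real_derivative 1) (at t)"
      by (rule has_field_derivative_transform_within_open[of _ _ _ "{u<..<v}"])
        (use that transl in auto)
  qed
  have pos: "deriv f ((f ^^ j) t) > 0" if "u < t" "t < v" "j < q" for t j
  proof -
    have "f ((f ^^ j) t) = g ((f ^^ j) t)"
      using agree[OF that(1,2), of j] agree[OF that(1,2), of "Suc j"] that(3) by simp
    then have "deriv f ((f ^^ j) t) \<ge> 0" by (rule deriv_nonneg_of_mono_minorant[OF g _ D])
    moreover have "deriv f ((f ^^ j) t) \<noteq> 0"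
    proof
      assume "deriv f ((f ^^ j) t) = 0"
      then have "(\<Prod>j<q. deriv f ((f ^^ j) t)) = 0" using that(3) by (intro prod_zero) auto
      then show False using prod[OF that(1,2)] by simp
    qed
    ultimately show ?thesis by simp
  qed
  \<comment> \<open>The hypotheses hold on the open interval only, so two interior points are
    compared.\<close>
  define a where "a = (2 * u + v) / 3"
  define b where "b = (u + 2 * v) / 3"
  have ab: "u < a" "a < b" "b < v" using \<open>u < v\<close> by (auto simp: a_def b_def)
  have "(\<Prod>j<q. deriv f ((f ^^ j) a)) * (\<Prod>j<q. deriv f ((f ^^ j) b)) * (b - a)\<^sup>2
    < ((f ^^ q) b - (f ^^ q) a)\<^sup>2"
  proof (rule schwarzian_two_point_funpow[OF ns ab(2) \<open>q > 0\<close>])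
    \<comment> \<open>By the intermediate value theorem \<open>r\<close> lies on the orbit of some
      point between \<open>a\<close> and \<open>b\<close>.\<close>
    fix j r assume jr: "j < q" "(f ^^ j) a < r" "r < (f ^^ j) b"
    have "continuous_on {a..b} (f ^^ j)"
      using continuous_on_funpow[OF C3_continuous(1)[OF \<open>C3 f\<close>]] continuous_on_subset by blast
    then obtain t where "a \<le> t" "t \<le> b" "(f ^^ j) t = r"
      using IVT'[of "f ^^ j" a r b] jr ab by auto
    then show "deriv f r > 0" using pos[of t j] jr(1) ab by auto
  qed
  then show False using ab prod transl by simp
qed

text \<open>A graph that meets the line \<open>t + c\<close> at \<open>u\<close>, coming from below
  on the left, is at least as steep as the line.\<close>

lemma derivative_ge_1_left:
  fixes h :: "real \<Rightarrow> real"
  assumes "(h has_real_derivative A) (at u)" "h u = u + c"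
    and "\<forall>\<^sub>F t in nhds u. t \<le> u \<longrightarrow> h t \<le> t + c"
  shows "A \<ge> 1"
proof (rule ccontr)
  assume "\<not> A \<ge> 1"
  moreover have "((\<lambda>t. h t - t) has_real_derivative A - 1) (at u)"
    by (auto intro!: derivative_eq_intros assms(1))
  ultimately obtain d where d: "d > 0" "\<And>e. 0 < e \<Longrightarrow> e < d \<Longrightarrow> h u - u < h (u - e) - (u - e)"
    using DERIV_neg_dec_left[of "\<lambda>t. h t - t" "A - 1" u] by auto
  obtain d' where d': "d' > 0" "\<And>t. dist t u < d' \<Longrightarrow> t \<le> u \<Longrightarrow> h t \<le> t + c"
    using assms(3) by (auto simp: eventually_nhds_metric)
  define e where "e = min d d' / 2"
  have "0 < e" "e < d" "e < d'" using d d' by (auto simp: e_def)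
  then show False using d(2)[of e] d'(2)[of "u - e"] assms(2) by (simp add: dist_real_def)
qed

lemma derivative_ge_1_right:
  fixes h :: "real \<Rightarrow> real"
  assumes "(h has_real_derivative A) (at u)" "h u = u + c"
    and "\<forall>\<^sub>F t in nhds u. u \<le> t \<longrightarrow> t + c \<le> h t"
  shows "A \<ge> 1"
proof (rule ccontr)
  assume "\<not> A \<ge> 1"
  moreover have "((\<lambda>t. h t - t) has_real_derivative A - 1) (at u)"
    by (auto intro!: derivative_eq_intros assms(1))
  ultimately obtain d where d: "d > 0" "\<And>e. 0 < e \<Longrightarrow> e < d \<Longrightarrow> h (u + e) - (u + e) < h u - u"
    using DERIV_neg_dec_right[of "\<lambda>t. h t - t" "A - 1" u] by auto
  obtain d' where d': "d' > 0" "\<And>t. dist t u < d' \<Longrightarrow> u \<le> t \<Longrightarrow> t + c \<le> h t"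
    using assms(3) by (auto simp: eventually_nhds_metric)
  define e where "e = min d d' / 2"
  have "0 < e" "e < d" "e < d'" using d d' by (auto simp: e_def)
  then show False using d(2)[of e] d'(2)[of "u + e"] assms(2) by (simp add: dist_real_def)
qed

text \<open>The sign of \<open>s\<close> selects the side of \<open>u\<close> on which the maps are compared.\<close>

lemma funpow_agree_one_sided:
  fixes f g :: "real \<Rightarrow> real" and s :: real
  assumes g: "mono g" "continuous_on UNIV g"
    and "\<And>j. \<forall>\<^sub>F t in nhds ((g ^^ j) u). 0 \<le> s * (t - (g ^^ j) u) \<longrightarrow> g t = f t"
  shows "\<forall>\<^sub>F t in nhds u. 0 \<le> s * (t - u) \<longrightarrow> (g ^^ i) t = (f ^^ i) t"
proof (induction i)
  case (Suc i)
  have "isCont (g ^^ i) u"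
    using continuous_on_funpow[OF g(2)] by (simp add: continuous_on_eq_continuous_at)
  then have "filterlim (g ^^ i) (nhds ((g ^^ i) u)) (nhds u)"
    by (simp add: isCont_def tendsto_at_iff_tendsto_nhds)
  from eventually_compose_filterlim[OF assms(3) this] Suc show ?case
  proof eventually_elim
    case (elim t)
    show ?case
    proof
      assume t: "0 \<le> s * (t - u)"
      have "0 \<le> s * ((g ^^ i) t - (g ^^ i) u)"
        using t funpow_mono[OF g(1), of t u i] funpow_mono[OF g(1), of u t i]
        by (auto simp: zero_le_mult_iff)
      then show "(g ^^ Suc i) t = (f ^^ Suc i) t" using elim t by simp
    qed
  qed
qed simp

section \<open>Bimodal lifts\<close>

text \<open>The conditions come in pairs exchanged by reflection: \<open>C\<close> with
  \<open>K\<close> and \<open>Km\<close> with \<open>Cp\<close>. \<open>Km\<close> and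
  \<open>Cp\<close> lie on the increasing branches next to the descent from \<open>C\<close> to
  \<open>K\<close>; the flat pieces of the lower and upper bound are \<open>[Km, K]\<close> and
  \<open>[C, Cp]\<close> modulo 1.\<close>

locale bimodal =
  fixes f :: "real \<Rightarrow> real" and C K Km Cp :: real
  assumes f: "degree_one_lift f"
    and CK: "C < K" "K < C + 1"
    and dec: "strict_antimono_on {C..K} f"
    and inc: "strict_mono_on {K..C + 1} f"
    and Km: "K - 1 < Km" "Km < C" "f Km = f K"
    and Cp: "K < Cp" "Cp < C + 1" "f Cp = f C"
begin

lemma lift_f: "is_lift f" "continuous_on UNIV f"
  using f by (auto simp: degree_one_lift_iff)

lemma f_add_int: "f (x + of_int n) = f x + of_int n"
  by (rule lift_add_int[OF lift_f(1)])

lemma f_add_1: "f (x + 1) = f x + 1"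
  using lift_f(1) by (simp add: is_lift_def)

lemma f_dec: "C \<le> x \<Longrightarrow> x < y \<Longrightarrow> y \<le> K \<Longrightarrow> f y < f x"
  using monotone_onD[OF dec] by simp

lemma f_inc: "K \<le> x \<Longrightarrow> x < y \<Longrightarrow> y \<le> C + 1 \<Longrightarrow> f x < f y"
  using monotone_onD[OF inc] by simp

lemma f_inc': "K - 1 \<le> x \<Longrightarrow> x < y \<Longrightarrow> y \<le> C \<Longrightarrow> f x < f y"
  using f_inc[of "x + 1" "y + 1"] by (simp add: f_add_1)

lemma bimodal_reflect: "bimodal (reflect f) (- K) (- C) (- Cp) (- Km)"
proof
  show "strict_antimono_on {- K..- C} (reflect f)"
    by (intro monotone_onI) (auto simp: reflect_def intro: f_dec)
  show "strict_mono_on {- C..- K + 1} (reflect f)"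
    by (intro monotone_onI) (auto simp: reflect_def intro: f_inc')
qed (use CK Km Cp f in \<open>auto simp: reflect_def degree_one_lift_reflect[unfolded reflect_def]
        intro: degree_one_lift_reflect\<close>)

lemma min_le: "K \<le> y \<Longrightarrow> y \<le> K + 1 \<Longrightarrow> f K \<le> f y"
proof (cases "y \<le> C + 1")
  case True
  assume "K \<le> y" "y \<le> K + 1"
  then show ?thesis using f_inc[of K y] True by (cases "y = K") auto
next
  case False
  assume "K \<le> y" "y \<le> K + 1"
  then have "f K \<le> f (y - 1)"
    using f_dec[of "y - 1" K] False by (cases "y = K + 1") auto
  then show ?thesis using f_add_1[of "y - 1"] by simp
qed

lemma min_le': "K \<le> y \<Longrightarrow> f K + of_int \<lfloor>y - K\<rfloor> \<le> f y"
proof -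
  define n where "n = \<lfloor>y - K\<rfloor>"
  have "K \<le> y + of_int (- n)" "y + of_int (- n) \<le> K + 1"
    unfolding n_def of_int_minus by linarith+
  then have "f K \<le> f (y + of_int (- n))" by (rule min_le)
  then show ?thesis unfolding f_add_int by (simp add: n_def)
qed

text \<open>Up to \<open>Km + 1\<close> the map has not risen above \<open>f K + 1\<close>, the
  minimum over the next period; until the descent to that minimum begins it is increasing.\<close>

lemma f_le_after:
  assumes "K \<le> x" "x \<le> Km + 1" "x \<le> y"
  shows "f x \<le> f y"
proof -
  have top: "f x \<le> f K + 1"
    using f_inc[of x "Km + 1"] assms Km f_add_1[of Km] by (cases "x = Km + 1") auto
  consider "y \<le> C + 1" | "C + 1 < y" "y \<le> K + 1" | "K + 1 < y" by linarith
  then show ?thesis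
  proof cases
    case 1
    then show ?thesis using f_inc[of x y] assms by (cases "x = y") auto
  next
    case 2
    then have "f K \<le> f (y - 1)" using f_dec[of "y - 1" K] by (cases "y = K + 1") auto
    then show ?thesis using f_add_1[of "y - 1"] top by simp
  next
    case 3
    then have "1 \<le> \<lfloor>y - K\<rfloor>" by linarith
    then have "f K + 1 \<le> f K + of_int \<lfloor>y - K\<rfloor>" by simp
    then show ?thesis using min_le'[of y] 3 top by linarith
  qed
qed

lemma lower_bound_eq_self: "K \<le> x \<Longrightarrow> x \<le> Km + 1 \<Longrightarrow> lower_bound f x = f x"
  using f_le_after by (intro lower_bound_eq[of _ _ _ x]) auto

lemma lower_bound_flat:
  assumes "Km \<le> x" "x \<le> K"
  shows "lower_bound f x = f K"
proof (rule lower_bound_eq[of _ _ _ K])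
  fix y assume "x \<le> y"
  consider "y \<le> C" | "C < y" "y \<le> K" | "K < y" by linarith
  then show "f K \<le> f y"
  proof cases
    case 1
    then show ?thesis using f_inc'[of Km y] Km \<open>x \<le> y\<close> assms by (cases "y = Km") auto
  next
    case 2
    then show ?thesis using f_dec[of y K] by (cases "y = K") auto
  next
    case 3
    then show ?thesis using f_le_after[of K y] Km CK by auto
  qed
qed (use assms in auto)

abbreviation "fl \<equiv> lower_bound f"
abbreviation "fu \<equiv> upper_bound f"

lemma lift_fl: "is_lift fl" and mono_fl: "mono fl" and cont_fl: "continuous_on UNIV fl"
  and fl_le: "fl x \<le> f x"
  using f by (auto simp: is_lift_lower_bound mono_lower_bound continuous_on_lower_bound lower_bound_le)

lemma lift_fu: "is_lift fu" and mono_fu: "mono fu" and cont_fu: "continuous_on UNIV fu"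
  and fu_ge: "f x \<le> fu x"
  using f degree_one_lift_upper_bound[OF f]
  by (auto simp: degree_one_lift_iff mono_upper_bound le_upper_bound)

lemma K_floor:
  obtains n :: int where "K + of_int n \<le> x" "x < K + of_int n + 1"
  by (rule that[of "\<lfloor>x - K\<rfloor>"]) linarith+

lemma K_ceiling:
  obtains n :: int where "K + of_int n < x" "x \<le> K + of_int n + 1"
  by (rule that[of "\<lceil>x - K\<rceil> - 1"]) (simp, linarith)+

lemma fl_agree_shift:
  assumes "K + of_int n \<le> x" "x \<le> Km + of_int n + 1"
  shows "fl x = f x"
proof -
  have "fl (x + of_int (- n)) = f (x + of_int (- n))"
    using assms by (intro lower_bound_eq_self) auto
  then show ?thesis unfolding f_add_int lift_add_int[OF lift_fl] by simp
qed

lemma fl_agree: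
  assumes "\<And>n::int. \<not> (Km + of_int n < x \<and> x < K + of_int n)"
  shows "fl x = f x"
proof -
  obtain n where n: "K + of_int n \<le> x" "x < K + of_int n + 1" by (rule K_floor)
  then show ?thesis using assms[of "n + 1"] by (intro fl_agree_shift[of n]) auto
qed

text \<open>The end points of a flat piece matter: to the left of \<open>K\<close> the bound is
  flat, to the left of \<open>Km\<close> it follows \<open>f\<close>, and on the right the roles are
  exchanged. Avoidance by periodic points gives exactly the left version; the right one can then
  fail only at \<open>Km\<close>.\<close>

lemma fl_agree_left:
  assumes "\<And>n::int. \<not> (Km + of_int n < x \<and> x \<le> K + of_int n)"
  shows "\<forall>\<^sub>F t in nhds x. t \<le> x \<longrightarrow> fl t = f t"
proof -
  obtain n where n: "K + of_int n < x" "x \<le> K + of_int n + 1" by (rule K_ceiling)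
  then have "x \<le> Km + of_int n + 1" using assms[of "n + 1"] by auto
  then have "t \<le> x \<longrightarrow> fl t = f t" if "K + of_int n < t" for t
    using that by (auto intro!: fl_agree_shift[of n])
  moreover have "\<forall>\<^sub>F t in nhds x. K + of_int n < t"
    using n(1) by (simp add: eventually_nhds_in_open[of "{K + of_int n<..}" x, simplified])
  ultimately show ?thesis by (auto elim: eventually_mono)
qed

lemma fl_agree_right:
  assumes "\<And>n::int. \<not> (Km + of_int n \<le> x \<and> x < K + of_int n)"
  shows "\<forall>\<^sub>F t in nhds x. x \<le> t \<longrightarrow> fl t = f t"
proof -
  obtain n where n: "K + of_int n \<le> x" "x < K + of_int n + 1" by (rule K_floor)
  then have less: "x < Km + of_int n + 1" using assms[of "n + 1"] by auto
  have "x \<le> t \<longrightarrow> fl t = f t" if "t < Km + of_int n + 1" for t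
    using that n by (auto intro!: fl_agree_shift[of n])
  moreover have "\<forall>\<^sub>F t in nhds x. t < Km + of_int n + 1"
    using less by (simp add: eventually_nhds_in_open[of "{..<Km + of_int n + 1}" x, simplified])
  ultimately show ?thesis by (auto elim: eventually_mono)
qed

text \<open>A periodic point inside a flat piece would push the left end of that piece above the
  diagonal.\<close>

lemma fl_periodic_avoids:
  assumes le: "\<And>x. (fl ^^ q) x \<le> x + of_int p" and "q > 0" and x: "x \<in> periodic_set fl q p"
  shows "\<not> (Km + of_int n < x \<and> x \<le> K + of_int n)"
proof
  assume xn: "Km + of_int n < x \<and> x \<le> K + of_int n"
  define y where "y = x + of_int (- n)"
  have y: "Km < y" "y \<le> K" using xn by (auto simp: y_def)
  have "y \<in> periodic_set fl q p" unfolding y_def by (rule periodic_set_add_int[OF lift_fl x])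
  then have "(fl ^^ q) y = y + of_int p" by (simp add: periodic_set_def)
  moreover have "(fl ^^ q) y = (fl ^^ q) Km"
  proof -
    obtain r where "q = Suc r" using \<open>q > 0\<close> gr0_implies_Suc by blast
    moreover have "fl y = fl Km" using y Km CK by (simp add: lower_bound_flat)
    ultimately show ?thesis by (simp add: funpow_Suc_right del: funpow.simps)
  qed
  ultimately show False using le[of Km] y by simp
qed

end

section \<open>The upper bound of a bimodal lift, by reflection\<close>

context bimodal
begin

interpretation refl: bimodal "reflect f" "- K" "- C" "- Cp" "- Km"
  by (rule bimodal_reflect)

lemma fu_eq: "fu x = - refl.fl (- x)"
  by (simp add: upper_bound_eq_reflect reflect_def)

lemma fu_agree:
  assumes "\<And>n::int. \<not> (C + of_int n < x \<and> x < Cp + of_int n)"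
  shows "fu x = f x"
proof -
  have "\<not> (- Cp + of_int n < - x \<and> - x < - C + of_int n)" for n
    using assms[of "- n"] by auto
  from refl.fl_agree[OF this] show ?thesis by (simp add: fu_eq reflect_def)
qed

lemma fu_agree_right:
  assumes "\<And>n::int. \<not> (C + of_int n \<le> x \<and> x < Cp + of_int n)"
  shows "\<forall>\<^sub>F t in nhds x. x \<le> t \<longrightarrow> fu t = f t"
proof -
  have "\<not> (- Cp + of_int n < - x \<and> - x \<le> - C + of_int n)" for n
    using assms[of "- n"] by auto
  from eventually_compose_filterlim[OF refl.fl_agree_left[OF this], of "\<lambda>t. - t" "nhds x"]
  have "\<forall>\<^sub>F t in nhds x. x \<le> t \<longrightarrow> refl.fl (- t) = - f t"
    by (simp add: reflect_def tendsto_minus filterlim_ident)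
  then show ?thesis by (rule eventually_mono) (simp add: fu_eq)
qed

lemma fu_agree_left:
  assumes "\<And>n::int. \<not> (C + of_int n < x \<and> x \<le> Cp + of_int n)"
  shows "\<forall>\<^sub>F t in nhds x. t \<le> x \<longrightarrow> fu t = f t"
proof -
  have "\<not> (- Cp + of_int n \<le> - x \<and> - x < - C + of_int n)" for n
    using assms[of "- n"] by auto
  from eventually_compose_filterlim[OF refl.fl_agree_right[OF this], of "\<lambda>t. - t" "nhds x"]
  have "\<forall>\<^sub>F t in nhds x. t \<le> x \<longrightarrow> refl.fl (- t) = - f t"
    by (simp add: reflect_def tendsto_minus filterlim_ident)
  then show ?thesis by (rule eventually_mono) (simp add: fu_eq)
qed

lemma fu_periodic_avoids:
  assumes ge: "\<And>x. (fu ^^ q) x \<ge> x + of_int p" and "q > 0" and x: "x \<in> periodic_set fu q p"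
  shows "\<not> (C + of_int n \<le> x \<and> x < Cp + of_int n)"
proof -
  have iter: "(fu ^^ q) t = - (refl.fl ^^ q) (- t)" for t
    by (simp add: upper_bound_eq_reflect funpow_reflect)
  have "(refl.fl ^^ q) t \<le> t + of_int (- p)" for t
    using ge[of "- t"] iter[of "- t"] by simp
  moreover have "- x \<in> periodic_set refl.fl q (- p)"
    using x iter[of x] by (simp add: periodic_set_def)
  ultimately show ?thesis
    using refl.fl_periodic_avoids[of q "- p" "- x" "- n"] \<open>q > 0\<close> by auto
qed

end

section \<open>The periodic orbit at a tip\<close>

text \<open>The tip enters only through the last two inequalities; the existence of periodic points
  is a hypothesis of the lemmas that need it.\<close>

locale bimodal_tip = bimodal +
  fixes q p q' :: nat and p' :: int
  assumes ns: "negative_schwarzian f"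
    and deriv_pos: "\<And>r. K < r \<Longrightarrow> r < C + 1 \<Longrightarrow> deriv f r > 0"
    and q_pos: "q > 0"
    and det: "int q' * int p - p' * int q = 1"
    and fl_iter_le: "\<And>x. (fl ^^ q) x \<le> x + of_int (int p)"
    and fu_iter_ge: "\<And>x. (fu ^^ q) x \<ge> x + of_int (int p)"
begin

sublocale l: periodic_mono_lift fl q "int p" q' p'
  using lift_fl mono_fl q_pos det by unfold_locales

sublocale u: periodic_mono_lift fu q "int p" q' p'
  using lift_fu mono_fu q_pos det by unfold_locales

lemma C3_f: "C3 f"
  using ns by (simp add: negative_schwarzian_def)

lemmas DERIV_f = C3_DERIV(1)[OF C3_f]

lemmas l_avoids = fl_periodic_avoids[OF fl_iter_le q_pos]
lemmas u_avoids = fu_periodic_avoids[OF fu_iter_ge q_pos]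

lemma deriv_f_add_int: "deriv f (x + of_int n) = deriv f x"
  by (rule deriv_add_int[OF lift_f(1) C3_f])

lemma deriv_f_pos:
  assumes "\<And>n::int. \<not> (C + of_int n \<le> r \<and> r \<le> K + of_int n)"
  shows "deriv f r > 0"
proof -
  obtain n where n: "K + of_int n \<le> r" "r < K + of_int n + 1" by (rule K_floor)
  have "K < r + of_int (- n)" "r + of_int (- n) < C + 1"
    using n assms[of n] assms[of "n + 1"] CK by auto
  from deriv_pos[OF this] show ?thesis unfolding deriv_f_add_int .
qed

lemma l_agree: "x \<in> l.P \<Longrightarrow> fl x = f x"
  using l_avoids by (intro fl_agree) force

lemma u_agree: "x \<in> u.P \<Longrightarrow> fu x = f x"
  using u_avoids by (intro fu_agree) force

lemma l_funpow: "x \<in> l.P \<Longrightarrow> (f ^^ i) x = (fl ^^ i) x"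
  by (induction i) (simp_all add: l_agree periodic_set_funpow[OF lift_fl])

lemma u_funpow: "x \<in> u.P \<Longrightarrow> (f ^^ i) x = (fu ^^ i) x"
  by (induction i) (simp_all add: u_agree periodic_set_funpow[OF lift_fu])

text \<open>If \<open>f\<close> agrees with both bounds on one side of an orbit, the two
  inequalities for their iterates squeeze \<open>f ^^ q\<close> to a translation there.\<close>

lemma no_common_agreement:
  assumes "s = 1 \<or> s = - 1"
    and l: "\<And>j. \<forall>\<^sub>F t in nhds ((fl ^^ j) w). 0 \<le> s * (t - (fl ^^ j) w) \<longrightarrow> fl t = f t"
    and u: "\<And>j. \<forall>\<^sub>F t in nhds ((fu ^^ j) w). 0 \<le> s * (t - (fu ^^ j) w) \<longrightarrow> fu t = f t"
  shows False
proof -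
  have "\<forall>\<^sub>F t in nhds w. \<forall>i\<in>{..q}. 0 \<le> s * (t - w) \<longrightarrow> (fl ^^ i) t = (f ^^ i) t"
    by (intro eventually_ball_finite ballI funpow_agree_one_sided mono_fl cont_fl l) simp
  moreover have "\<forall>\<^sub>F t in nhds w. 0 \<le> s * (t - w) \<longrightarrow> (fu ^^ q) t = (f ^^ q) t"
    by (intro funpow_agree_one_sided mono_fu cont_fu u)
  ultimately have "\<forall>\<^sub>F t in nhds w. 0 \<le> s * (t - w) \<longrightarrow>
      (\<forall>i\<le>q. (fl ^^ i) t = (f ^^ i) t) \<and> (f ^^ q) t = t + real p"
  proof eventually_elim
    case (elim t)
    show ?case
    proof
      assume t: "0 \<le> s * (t - w)"
      then have "(fl ^^ q) t = (f ^^ q) t" "(fu ^^ q) t = (f ^^ q) t" using elim by auto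
      then have "(f ^^ q) t = t + real p" using fl_iter_le[of t] fu_iter_ge[of t] by simp
      then show "(\<forall>i\<le>q. (fl ^^ i) t = (f ^^ i) t) \<and> (f ^^ q) t = t + real p" using elim t by auto
    qed
  qed
  then obtain d where d: "d > 0" "\<And>t. dist t w < d \<Longrightarrow> 0 \<le> s * (t - w) \<Longrightarrow>
      (\<forall>i\<le>q. (fl ^^ i) t = (f ^^ i) t) \<and> (f ^^ q) t = t + real p"
    by (auto simp: eventually_nhds_metric)
  define a where "a = (if s = 1 then w else w - d)"
  have side: "dist t w < d \<and> 0 \<le> s * (t - w)" if "a < t" "t < a + d" for t
    using that assms(1) by (auto simp: a_def dist_real_def split: if_splits)
  show False
  proof (rule no_translation_iterate[OF ns q_pos _ mono_fl fl_le, of a "a + d" "real p"])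
    show "(fl ^^ i) t = (f ^^ i) t" if "a < t" "t < a + d" "i \<le> q" for t i
      using side[OF that(1,2)] d(2)[of t] that(3) by auto
    show "(f ^^ q) t = t + real p" if "a < t" "t < a + d" for t
      using side[OF that] d(2)[of t] by auto
  qed (use d in auto)
qed

end

text \<open>Only forward halves of the orbits are indexed. Adding \<open>n * q\<close> to the index
  translates a point by \<open>n\<close>, so negative translations are avoided by moving both sides
  forward.\<close>

locale interlaced_tip = bimodal_tip +
  fixes X Y :: "nat \<Rightarrow> real"
  assumes X_in: "\<And>k. X k \<in> l.P" and Y_in: "\<And>k. Y k \<in> u.P"
    and X_Suc: "\<And>k. X (Suc k) = l.T (X k)" and Y_Suc: "\<And>k. Y (Suc k) = u.T (Y k)"
    and YX: "\<And>k. Y k < X k" and XY: "\<And>k. X k \<le> Y (Suc k)"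
begin

lemma X_add: "X (k + i) = (l.T ^^ i) (X k)"
  by (induction i) (auto simp: X_Suc)

lemma Y_add: "Y (k + i) = (u.T ^^ i) (Y k)"
  by (induction i) (auto simp: Y_Suc)

lemma X_shift: "X (k + n * q) = X k + real n"
  using l.funpow_T_mult[OF X_in, of 0 n k] by (simp add: X_add)

lemma Y_shift: "Y (k + n * q) = Y k + real n"
  using u.funpow_T_mult[OF Y_in, of 0 n k] by (simp add: Y_add)

lemma X_mono: "strict_mono X"
  using l.T_gt[OF X_in] by (simp add: strict_mono_Suc_iff X_Suc)

lemma Y_mono: "strict_mono Y"
  using u.T_gt[OF Y_in] by (simp add: strict_mono_Suc_iff Y_Suc)

lemma fl_X: "fl (X k) = X (k + p)"
  using l.funpow_T_p[OF X_in, of p k] by (simp add: X_add)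

lemma fu_Y: "fu (Y k) = Y (k + p)"
  using u.funpow_T_p[OF Y_in, of p k] by (simp add: Y_add)

lemma f_iter_X: "(f ^^ i) (X k) = X (k + i * p)"
  by (induction i) (simp_all add: fl_X add_ac flip: l_agree[OF X_in])

lemma f_iter_Y: "(f ^^ i) (Y k) = Y (k + i * p)"
  by (induction i) (simp_all add: fu_Y add_ac flip: u_agree[OF Y_in])

text \<open>Otherwise the gap between \<open>X k\<close> and \<open>Y (Suc k)\<close> contains a
  translate of \<open>[Km, Cp]\<close>, hence of both flat pieces. The intervals
  \<open>[Y j, X j]\<close> then miss the interior of all flat pieces, and on them \<open>f\<close>
  equals both bounds, which makes \<open>f ^^ q\<close> a translation.\<close>

lemma not_straddling: "\<not> (X k \<le> Km + of_int n \<and> Cp + of_int n \<le> Y (Suc k))"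
proof
  assume str: "X k \<le> Km + of_int n \<and> Cp + of_int n \<le> Y (Suc k)"
  have free: "\<not> (Km + of_int m < t \<and> t < Cp + of_int m)" if "Y j \<le> t" "t \<le> X j" for j t m
  proof
    assume tm: "Km + of_int m < t \<and> t < Cp + of_int m"
    \<comment> \<open>Both points are moved forward to a common level \<open>m + N = n + e\<close>
      with natural \<open>N\<close> and \<open>e\<close>.\<close>
    define N where "N = nat \<bar>m - n\<bar>"
    define e where "e = nat (int N + m - n)"
    have e: "real_of_int m + real N = real_of_int n + real e"
      unfolding N_def e_def by (simp add: of_nat_nat)
    have 1: "X (k + e * q) < t + real N" "t + real N < Y (Suc k + e * q)"
      using str tm e by (auto simp only: X_shift Y_shift)
    have 2: "Y (j + N * q) \<le> t + real N" "t + real N \<le> X (j + N * q)"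
      using that by (simp_all add: X_shift Y_shift)
    show False
    \<comment> \<open>The moved point lies strictly inside a gap and also in some
      \<open>[Y, X]\<close>; the order of the indices decides which end of the gap is
      violated.\<close>
    proof (cases "j + N * q \<le> k + e * q")
      case True
      then have "X (j + N * q) \<le> X (k + e * q)" by (simp add: strict_mono_less_eq[OF X_mono])
      then show False using 1 2 by simp
    next
      case False
      then have "Y (Suc k + e * q) \<le> Y (j + N * q)" by (simp add: strict_mono_less_eq[OF Y_mono])
      then show False using 1 2 by simp
    qed
  qed
  have agree: "fl t = f t" "fu t = f t" if "Y j \<le> t" "t \<le> X j" for j t
  proof -
    show "fl t = f t"
    proof (rule fl_agree)
      show "\<not> (Km + of_int m < t \<and> t < K + of_int m)" for m using free[OF that, of m] Cp by auto
    qed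
    show "fu t = f t"
    proof (rule fu_agree)
      show "\<not> (C + of_int m < t \<and> t < Cp + of_int m)" for m using free[OF that, of m] Km by auto
    qed
  qed
  have iter: "(fl ^^ i) t = (f ^^ i) t \<and> (fu ^^ i) t = (f ^^ i) t \<and>
      Y (i * p) \<le> (f ^^ i) t \<and> (f ^^ i) t \<le> X (i * p)" if "Y 0 \<le> t" "t \<le> X 0" for t i
  proof (induction i)
    case (Suc i)
    have "fl ((f ^^ i) t) \<le> fl (X (i * p))" "fu (Y (i * p)) \<le> fu ((f ^^ i) t)"
      using Suc monoD[OF mono_fl] monoD[OF mono_fu] by auto
    then show ?case using Suc agree[of "i * p" "(f ^^ i) t"] by (simp add: fl_X fu_Y add.commute)
  qed (use that in simp)
  show False
  proof (rule no_translation_iterate[OF ns q_pos YX mono_fl fl_le])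
    show "(fl ^^ i) t = (f ^^ i) t" if "Y 0 < t" "t < X 0" for t i
      using iter[of t i] that by simp
    show "(f ^^ q) t = t + real p" if "Y 0 < t" "t < X 0" for t
      using iter[of t q] that fl_iter_le[of t] fu_iter_ge[of t] by simp
  qed
qed

lemma X_eq_Y: "X k = Y (Suc k)"
proof (rule ccontr)
  assume "X k \<noteq> Y (Suc k)"
  then have less: "X k < Y (Suc k)" using XY[of k] by simp
  let ?A = "\<Prod>j<q. deriv f ((f ^^ j) (X k))" and ?B = "\<Prod>j<q. deriv f ((f ^^ j) (Y (Suc k)))"
  have qX: "(f ^^ q) (X k) = X k + real p" and qY: "(f ^^ q) (Y (Suc k)) = Y (Suc k) + real p"
    using X_shift[of k p] Y_shift[of "Suc k" p] by (simp_all add: f_iter_X f_iter_Y mult.commute)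
  have "?A * ?B * (Y (Suc k) - X k)\<^sup>2 < ((f ^^ q) (Y (Suc k)) - (f ^^ q) (X k))\<^sup>2"
  proof (rule schwarzian_two_point_funpow[OF ns less q_pos])
    fix j r assume "(f ^^ j) (X k) < r" "r < (f ^^ j) (Y (Suc k))"
    then have r: "X (k + j * p) < r" "r < Y (Suc (k + j * p))" by (simp_all add: f_iter_X f_iter_Y)
    show "deriv f r > 0"
    proof (rule deriv_f_pos)
      \<comment> \<open>If \<open>r\<close> lies on a descending piece, avoidance pushes the
        \<open>X\<close> end of the gap back to \<open>Km + n\<close> or beyond, and the
        \<open>Y\<close> end forward to \<open>Cp + n\<close> or beyond: the gap would
        straddle.\<close>
      show "\<not> (C + of_int n \<le> r \<and> r \<le> K + of_int n)" for n
        using r not_straddling[of "k + j * p" n] l_avoids[OF X_in, of n "k + j * p"]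
          u_avoids[OF Y_in, of n "Suc (k + j * p)"] by auto
    qed
  qed
  \<comment> \<open>Both ends move by exactly \<open>p\<close>, so the squared lengths
    cancel.\<close>
  then have "?A * ?B < 1" using less by (simp add: qX qY)
  \<comment> \<open>Left of an \<open>X\<close> point \<open>f ^^ q\<close> agrees with the iterate
    of \<open>fl\<close>, which stays below the line \<open>t + p\<close>; for \<open>?B\<close> the
    argument uses \<open>fu\<close> on the right of a \<open>Y\<close> point.\<close>
  moreover have "?A \<ge> 1"
  proof (rule derivative_ge_1_left[OF DERIV_funpow[OF DERIV_f] qX])
    have "\<forall>\<^sub>F t in nhds ((fl ^^ j) (X k)). 0 \<le> - 1 * (t - (fl ^^ j) (X k)) \<longrightarrow> fl t = f t" for j
      using fl_agree_left[OF l_avoids[OF periodic_set_funpow[OF lift_fl X_in]], of j k] by simp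
    from funpow_agree_one_sided[OF mono_fl cont_fl this]
    have "\<forall>\<^sub>F t in nhds (X k). t \<le> X k \<longrightarrow> (fl ^^ q) t = (f ^^ q) t" by simp
    then show "\<forall>\<^sub>F t in nhds (X k). t \<le> X k \<longrightarrow> (f ^^ q) t \<le> t + real p"
      by (rule eventually_mono) (use fl_iter_le in \<open>metis of_int_of_nat_eq\<close>)
  qed
  moreover have "?B \<ge> 1"
  proof (rule derivative_ge_1_right[OF DERIV_funpow[OF DERIV_f] qY])
    have "\<forall>\<^sub>F t in nhds ((fu ^^ j) (Y (Suc k))). 0 \<le> 1 * (t - (fu ^^ j) (Y (Suc k))) \<longrightarrow> fu t = f t" for j
      using fu_agree_right[OF u_avoids[OF periodic_set_funpow[OF lift_fu Y_in]], of j "Suc k"] by simp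
    from funpow_agree_one_sided[OF mono_fu cont_fu this]
    have "\<forall>\<^sub>F t in nhds (Y (Suc k)). Y (Suc k) \<le> t \<longrightarrow> (fu ^^ q) t = (f ^^ q) t" by simp
    then show "\<forall>\<^sub>F t in nhds (Y (Suc k)). Y (Suc k) \<le> t \<longrightarrow> t + real p \<le> (f ^^ q) t"
      by (rule eventually_mono) (use fu_iter_ge in \<open>metis of_int_of_nat_eq\<close>)
  qed
  ultimately show False using mult_mono[of 1 ?A 1 ?B] by simp
qed

lemma X_in': "X k \<in> u.P"
  using Y_in X_eq_Y by simp

lemma fl_iter_X: "(fl ^^ i) (X k) = X (k + i * p)"
  using l_funpow[OF X_in, of i k] f_iter_X by simp

lemma fu_iter_X: "(fu ^^ i) (X k) = X (k + i * p)"
  using u_funpow[OF X_in', of i k] f_iter_X by simp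

text \<open>To the right of orbit points \<open>fu\<close> always agrees with \<open>f\<close>, and
  \<open>fl\<close> does so unless the point is \<open>Km\<close> modulo 1.\<close>

lemma Km_in_orbit: "\<exists>k n. X k = Km + of_int n"
proof (rule ccontr)
  assume "\<nexists>k n. X k = Km + of_int n"
  then have "Km + of_int n \<noteq> X k" for k n by metis
  then have "\<not> (Km + of_int n \<le> X k \<and> X k < K + of_int n)" for k n
    using l_avoids[OF X_in, of n k] by (auto simp: le_less)
  note l = fl_agree_right[OF this] and u = fu_agree_right[OF u_avoids[OF X_in']]
  show False
    by (rule no_common_agreement[of 1 "X 0"]) (use l u in \<open>simp_all add: fl_iter_X fu_iter_X\<close>)
qed

text \<open>The mirror image of the preceding argument, on the left of the orbit.\<close>

lemma Cp_in_orbit: "\<exists>k n. X k = Cp + of_int n"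
proof (rule ccontr)
  assume "\<nexists>k n. X k = Cp + of_int n"
  then have "X k \<noteq> Cp + of_int n" for k n by blast
  then have "\<not> (C + of_int n < X k \<and> X k \<le> Cp + of_int n)" for k n
    using u_avoids[OF X_in', of n k] by (auto simp: le_less)
  note u = fu_agree_left[OF this] and l = fl_agree_left[OF l_avoids[OF X_in]]
  show False
    by (rule no_common_agreement[of "- 1" "X 0"]) (use l u in \<open>simp_all add: fl_iter_X fu_iter_X\<close>)
qed

lemma Km_in: "Km \<in> l.P" "Km \<in> u.P"
proof -
  obtain k n where "X k = Km + of_int n" using Km_in_orbit by blast
  then have "Km = X k + of_int (- n)" by simp
  then show "Km \<in> l.P" "Km \<in> u.P"
    using periodic_set_add_int[OF lift_fl X_in] periodic_set_add_int[OF lift_fu X_in'] by metis+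
qed

lemma Cp_in: "Cp \<in> l.P" "Cp \<in> u.P"
proof -
  obtain k n where "X k = Cp + of_int n" using Cp_in_orbit by blast
  then have "Cp = X k + of_int (- n)" by simp
  then show "Cp \<in> l.P" "Cp \<in> u.P"
    using periodic_set_add_int[OF lift_fl X_in] periodic_set_add_int[OF lift_fu X_in'] by metis+
qed

text \<open>The next orbit point after \<open>Km\<close> must jump over \<open>(Km, K]\<close> and,
  being periodic for \<open>fu\<close> too, over \<open>[C, Cp)\<close>. It cannot pass
  \<open>Cp\<close>, which is itself on the orbit.\<close>

lemma T_Km: "l.T Km = Cp"
proof (rule antisym)
  have "l.T Km = u.T Km"
    using l_funpow[OF Km_in(1)] u_funpow[OF Km_in(2)] by (simp add: step_map_def)
  then have "l.T Km \<in> u.P" using u.T_in_P[OF Km_in(2)] by simp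
  moreover have "l.T Km > K"
    using l.T_gt[OF Km_in(1)] l_avoids[OF l.T_in_P[OF Km_in(1)], of 0] by simp
  ultimately show "Cp \<le> l.T Km" using u_avoids[of "l.T Km" 0] CK by simp
next
  obtain i n where i: "X i = Km + of_int n" using Km_in_orbit by blast
  obtain j m where j: "X j = Cp + of_int m" using Cp_in_orbit by blast
  \<comment> \<open>Moves both points to the same integer translate, so that their indices can be
    compared.\<close>
  define i' where "i' = i + nat (m - n) * q"
  define j' where "j' = j + nat (n - m) * q"
  have i': "X i' = Km + of_int (max n m)"
    using i unfolding i'_def X_shift by (auto simp: max_def of_nat_nat)
  have j': "X j' = Cp + of_int (max n m)"
    using j unfolding j'_def X_shift by (auto simp: max_def of_nat_nat)
  have "X i' < X j'" using i' j' Km Cp CK by simp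
  then have "Suc i' \<le> j'" by (simp add: strict_mono_less[OF X_mono])
  then have "X (Suc i') \<le> X j'" by (simp add: strict_mono_less_eq[OF X_mono])
  moreover have "X (Suc i') = l.T Km + of_int (max n m)"
    unfolding X_Suc i' l.T_add_int ..
  ultimately show "l.T Km \<le> Cp" using j' by simp
qed

end

section \<open>Return times of \<open>Km\<close> and \<open>Cp\<close> at a tip\<close>

context bimodal_tip
begin

lemma tip_orbit:
  assumes "l.P \<noteq> {}" "u.P \<noteq> {}"
  shows "Km \<in> l.P" "Cp \<in> l.P" "Cp \<in> u.P" "(f ^^ q') Km = Cp + of_int p'"
proof -
  obtain x y0 where x: "x \<in> l.P" and "y0 \<in> u.P" using assms by blast
  obtain y where y: "y \<in> u.P" "\<And>k. (u.T ^^ k) y < (l.T ^^ k) x" "\<And>k. (l.T ^^ k) x \<le> (u.T ^^ Suc k) y"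
    using interlacing[OF l.periodic_mono_lift_axioms u.periodic_mono_lift_axioms _ x \<open>y0 \<in> u.P\<close>]
      order_trans[OF fl_le fu_ge] by blast
  interpret interlaced_tip f C K Km Cp q p q' p' "\<lambda>k. (l.T ^^ k) x" "\<lambda>k. (u.T ^^ k) y"
    using x y by unfold_locales (auto intro: l.funpow_T_in_P u.funpow_T_in_P)
  show "Km \<in> l.P" "Cp \<in> l.P" "Cp \<in> u.P" by (rule Km_in Cp_in)+
  show "(f ^^ q') Km = Cp + of_int p'"
    using T_Km l_funpow[OF Km_in(1), of q'] by (simp add: step_map_def)
qed

text \<open>A repeated point returns to itself after \<open>k - i\<close> iterates, hence also after
  \<open>(k - i) * q\<close>, although these move it by \<open>(k - i) * p > 0\<close>.\<close>

lemma no_return: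
  assumes "x \<in> l.P" "p > 0" "i < k" "(f ^^ i) x = (f ^^ k) x"
  shows False
proof -
  define z where "z = (fl ^^ i) x"
  have z: "z \<in> l.P" unfolding z_def by (rule periodic_set_funpow[OF lift_fl assms(1)])
  have "(fl ^^ (k - i)) z = (fl ^^ (k - i + i)) x" unfolding funpow_add_apply z_def ..
  then have period: "(fl ^^ (k - i)) z = z"
    using assms(3,4) by (simp add: l_funpow[OF assms(1)] z_def)
  have "((fl ^^ (k - i)) ^^ m) z = z" for m by (induction m) (simp_all add: period)
  then have "(fl ^^ ((k - i) * q)) z = z" by (simp add: funpow_mult mult.commute)
  then show False using periodic_set_mult[OF lift_fl z, of "k - i"] assms(2,3) by simp
qed

lemma Km_orbit:
  assumes "l.P \<noteq> {}" "u.P \<noteq> {}"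
  shows "(f ^^ q') Km = Cp + of_int p'"
    and "\<not> (Km + of_int n < (f ^^ i) Km \<and> (f ^^ i) Km \<le> K + of_int n)"
    and "p > 0 \<Longrightarrow> i < q' \<Longrightarrow> (f ^^ i) Km \<noteq> Cp + of_int p'"
proof -
  note orb = tip_orbit[OF assms]
  show ret: "(f ^^ q') Km = Cp + of_int p'" by (rule orb)
  show "\<not> (Km + of_int n < (f ^^ i) Km \<and> (f ^^ i) Km \<le> K + of_int n)"
    unfolding l_funpow[OF orb(1)] by (rule l_avoids[OF periodic_set_funpow[OF lift_fl orb(1)]])
  show "p > 0 \<Longrightarrow> i < q' \<Longrightarrow> (f ^^ i) Km \<noteq> Cp + of_int p'"
    using no_return[OF orb(1), of i q'] ret by auto
qed

text \<open>Going from \<open>Km\<close> to \<open>Cp\<close> takes \<open>q'\<close> iterates;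
  \<open>q'' + q'\<close> turns out to be a multiple of \<open>q\<close>, so \<open>q''\<close>
  further ones complete whole periods and lead back to \<open>Km\<close> up to translation.\<close>

lemma Cp_orbit:
  assumes "l.P \<noteq> {}" "u.P \<noteq> {}" and pq: "p'' * int q - int q'' * int p = 1"
  shows "(f ^^ q'') Cp = Km + of_int p''"
    and "\<not> (C + of_int n \<le> (f ^^ i) Cp \<and> (f ^^ i) Cp < Cp + of_int n)"
    and "p > 0 \<Longrightarrow> i < q'' \<Longrightarrow> (f ^^ i) Cp \<noteq> Km + of_int p''"
proof -
  note orb = tip_orbit[OF assms(1,2)]
  have sum: "(int q'' + int q') * int p = (p'' + p') * int q" using det pq by (simp add: algebra_simps)
  \<comment> \<open>Obtained by multiplying \<open>q'' + q'\<close> by the identity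
    \<open>pq\<close> and replacing \<open>(q'' + q') * p\<close> with
    \<open>(p'' + p') * q\<close>, after which \<open>q\<close> can be factored out.\<close>
  define n where "n = (int q'' + int q') * p'' - int q'' * (p'' + p')"
  have n: "int q'' + int q' = n * int q"
  proof -
    have "n * int q = (int q'' + int q') * (p'' * int q) - int q'' * ((p'' + p') * int q)"
      by (simp add: n_def algebra_simps)
    also have "\<dots> = (int q'' + int q') * (p'' * int q - int q'' * int p)"
      unfolding sum[symmetric] by (simp add: algebra_simps)
    finally show ?thesis by (simp add: pq)
  qed
  have p: "n * int p = p'' + p'"
  proof -
    have "(n * int p) * int q = (n * int q) * int p" by simp
    then have "(n * int p) * int q = (p'' + p') * int q" unfolding n[symmetric] sum .
    then show ?thesis using q_pos by simp
  qed
  have "Cp = (f ^^ q') Km + of_int (- p')" using orb(4) by simp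
  then have "(f ^^ q'') Cp = (f ^^ q'') ((f ^^ q') Km + of_int (- p'))" by simp
  also have "\<dots> = (f ^^ (q'' + q')) Km - of_int p'"
    unfolding funpow_add_int[OF lift_f(1)] funpow_add_apply by simp
  also have "(f ^^ (q'' + q')) Km = Km + of_int (n * int p)"
    using periodic_set_shift[OF lift_fl orb(1), of "q'' + q'" 0 n] n by (simp add: l_funpow[OF orb(1)])
  finally show ret: "(f ^^ q'') Cp = Km + of_int p''" by (simp add: p)
  show "\<not> (C + of_int n \<le> (f ^^ i) Cp \<and> (f ^^ i) Cp < Cp + of_int n)" for n
    unfolding u_funpow[OF orb(3)] by (rule u_avoids[OF periodic_set_funpow[OF lift_fu orb(3)]])
  show "p > 0 \<Longrightarrow> i < q'' \<Longrightarrow> (f ^^ i) Cp \<noteq> Km + of_int p''"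
    using no_return[OF orb(2), of i q''] ret by auto
qed

end

section \<open>The critical line\<close>

lemma lower_bound_mono_eq: "mono f \<Longrightarrow> lower_bound f = f"
  by (rule ext, rule lower_bound_eq[OF _ order_refl refl]) (rule monoD)

lemma upper_bound_mono_eq: "mono f \<Longrightarrow> upper_bound f = f"
  by (simp add: upper_bound_eq_reflect lower_bound_mono_eq mono_reflect)

lemma Delta_eq_0_of_mono:
  assumes "mono f"
  shows "Delta f = 0"
proof -
  have "(SUP x\<in>A. infdist x A) = 0" if "A \<noteq> {}" for A :: "(real \<times> real) set"
    using that by (simp cong: SUP_cong)
  moreover have "graph_of f \<noteq> {}" by (auto simp: graph_of_def)
  ultimately show ?thesis
    using assms by (simp add: Delta_def hausdorff_dist_def lower_bound_mono_eq upper_bound_mono_eq)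
qed

text \<open>A descent from \<open>x\<close> to \<open>y\<close> separates the graphs at the midpoint
  \<open>m\<close>: the upper bound is at least \<open>f x\<close> there, while the lower one is at
  most \<open>f y\<close> everywhere to the left of \<open>y\<close>.\<close>

lemma mono_of_Delta_eq_0:
  assumes f: "degree_one_lift f" and "Delta f = 0"
  shows "mono f"
proof (rule ccontr)
  assume "\<not> mono f"
  then obtain x y where "x \<le> y" "\<not> f x \<le> f y" by (auto simp: mono_def)
  then have xy: "x < y" "f y < f x" by (auto simp: le_less)
  define m where "m = (x + y) / 2"
  let ?L = "graph_of (lower_bound f)" and ?U = "graph_of (upper_bound f)"
  have m: "x < m" "m < y" using xy by (auto simp: m_def)
  have neL: "?L \<noteq> {}" by (auto simp: graph_of_def)
  obtain M where M: "\<And>x. \<bar>f x - x\<bar> \<le> M"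
    using lift_displacement_bounded f unfolding degree_one_lift_iff by metis
  have lowerM: "z - M \<le> lower_bound f z" for z
    unfolding lower_bound_def
  proof (rule cINF_greatest)
    fix w assume "w \<in> {z..}" then show "z - M \<le> f w" using M[of w] by simp
  qed simp
  have upperM: "upper_bound f z \<le> z + M" for z
    unfolding upper_bound_def
  proof (rule cSUP_least)
    fix w assume "w \<in> {..z}" then show "f w \<le> z + M" using M[of w] by simp
  qed simp
  have le: "lower_bound f z \<le> upper_bound f z" for z
    using lower_bound_le[OF f, of z z] le_upper_bound[OF f, of z z] by simp
  have "infdist v ?L \<le> 2 * M" if "v \<in> ?U" for v
  proof -
    obtain z where z: "v = (z, upper_bound f z)" using \<open>v \<in> ?U\<close> by (auto simp: graph_of_def)
    have "infdist v ?L \<le> dist v (z, lower_bound f z)"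
      by (rule infdist_le) (auto simp: graph_of_def)
    also have "\<dots> \<le> 2 * M"
      using lowerM[of z] upperM[of z] le[of z] by (simp add: z dist_Pair_Pair dist_real_def)
    finally show ?thesis .
  qed
  \<comment> \<open>Needed for the supremum in \<open>Delta\<close> to dominate the individual
    distances.\<close>
  then have bdd: "bdd_above ((\<lambda>v. infdist v ?L) ` ?U)" by (rule bdd_aboveI2)
  have "infdist (m, upper_bound f m) ?L \<le> (SUP v\<in>?U. infdist v ?L)"
    by (rule cSUP_upper[OF _ bdd]) (auto simp: graph_of_def)
  also have "\<dots> \<le> 0" using assms(2) by (simp add: Delta_def hausdorff_dist_def max_def split: if_splits)
  finally have "infdist (m, upper_bound f m) ?L = 0" using infdist_nonneg[of "(m, upper_bound f m)" ?L] by linarith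
  then have clos: "(m, upper_bound f m) \<in> closure ?L"
    using in_closure_iff_infdist_zero[OF neL] by simp
  \<comment> \<open>Within \<open>e\<close> of \<open>m\<close> one stays to the left of
    \<open>y\<close>, and \<open>e\<close> is at most the height of the descent.\<close>
  define e where "e = min (y - m) (f x - f y)"
  have e: "e > 0" using xy m by (simp add: e_def)
  obtain v where v: "v \<in> ?L" "dist v (m, upper_bound f m) < e"
    using clos e unfolding closure_approachable by blast
  obtain z where z: "v = (z, lower_bound f z)" using v(1) by (auto simp: graph_of_def)
  have "\<bar>z - m\<bar> < e" "\<bar>lower_bound f z - upper_bound f m\<bar> < e"
    using v(2) dist_fst_le[of v "(m, upper_bound f m)"] dist_snd_le[of v "(m, upper_bound f m)"]
    by (auto simp: z dist_real_def)
  moreover have "lower_bound f z \<le> f y"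
    using \<open>\<bar>z - m\<bar> < e\<close> by (intro lower_bound_le[OF f]) (auto simp: e_def)
  moreover have "f x \<le> upper_bound f m" using m by (intro le_upper_bound[OF f]) auto
  ultimately show False by (auto simp: e_def)
qed

lemma not_mono_deriv_neg:
  assumes "C3 f" "\<not> mono f"
  obtains x where "deriv f x < 0"
proof (rule ccontr)
  assume "\<not> thesis"
  then have "deriv f x \<ge> 0" for x using that by (meson not_le)
  have "mono f"
  proof (intro monoI)
    show "f x \<le> f y" if "x \<le> y" for x y
      by (rule DERIV_nonneg_imp_nondecreasing[OF that])
        (use \<open>\<And>x. deriv f x \<ge> 0\<close> C3_DERIV(1)[OF assms(1)] in blast)
  qed
  then show False using assms(2) by simp
qed

context
  fixes F :: family
  assumes N: "class_N F"
begin

lemma class_N_D: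
  shows "class_B (F a b)"
    and "continuous_on UNIV (\<lambda>(a, b, x). F a b x)"
    and "continuous_on UNIV (\<lambda>(a, b, x). deriv (F a b) x)"
    and "F a b x = F 0 b x + a"
    and "mono (\<lambda>b. Delta (F a b))"
    and "\<exists>b. Delta (F a b) = 0" and "\<exists>b. Delta (F a b) > 1"
    and "b > critical_height F \<Longrightarrow> C_pt F b < K_pt F b"
  using N unfolding class_N_def by blast+

lemma class_N_lift: "degree_one_lift (F a b)"
  using class_N_D(1) by (simp add: class_B_def)

lemma class_N_C3: "C3 (F a b)"
  using class_N_D(1) by (simp add: class_B_def)

text \<open>The \<open>GREATEST\<close> is attained: the heights with a monotone map form a closed
  set, by continuity in \<open>b\<close>, and a bounded one, since \<open>Delta\<close> is
  nondecreasing and exceeds 1 somewhere.\<close>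

lemma critical_height_mono:
  shows "mono (F 0 (critical_height F))" and "critical_height F < b \<Longrightarrow> \<not> mono (F 0 b)"
proof -
  define S where "S = {b. Delta (F 0 b) = 0}"
  have S: "S = {b. mono (F 0 b)}"
    unfolding S_def using Delta_eq_0_of_mono mono_of_Delta_eq_0[OF class_N_lift] by blast
  have cont: "continuous_on UNIV (\<lambda>b. F 0 b x)" for x
  proof -
    have "continuous_on UNIV (\<lambda>(a, b, x). F a b x)" by (rule class_N_D(2))
    moreover have "continuous_on UNIV (\<lambda>b. (0 :: real, b :: real, x))"
      by (intro continuous_on_Pair continuous_on_const continuous_on_id)
    ultimately have "continuous_on UNIV (\<lambda>b. case (0, b, x) of (a, b, x) \<Rightarrow> F a b x)"
      by (rule continuous_on_compose2) simp
    then show ?thesis by simp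
  qed
  have "closed S"
    unfolding S mono_def
  proof (intro closed_Collect_all)
    show "closed {b. x \<le> y \<longrightarrow> F 0 b x \<le> F 0 b y}" for x y
      by (cases "x \<le> y") (simp_all add: closed_Collect_le cont)
  qed
  obtain b1 where b1: "Delta (F 0 b1) > 1" using class_N_D(7) by blast
  have "b \<le> b1" if "b \<in> S" for b
  proof (rule ccontr)
    assume "\<not> b \<le> b1"
    moreover have "mono (\<lambda>b. Delta (F 0 b))" by (rule class_N_D(5))
    ultimately have "Delta (F 0 b1) \<le> Delta (F 0 b)" by (simp add: monoD[of "\<lambda>b. Delta (F 0 b)"])
    then show False using that b1 by (simp add: S_def)
  qed
  then have bdd: "bdd_above S" by (auto simp: bdd_above_def)
  have "S \<noteq> {}" using class_N_D(6) by (simp add: S_def)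
  then have Sup: "Sup S \<in> S" using bdd \<open>closed S\<close> by (intro closed_contains_Sup)
  have upper: "b \<le> Sup S" if "b \<in> S" for b by (rule cSup_upper[OF that bdd])
  have crit: "critical_height F = Sup S"
    unfolding critical_height_def using Sup upper by (intro Greatest_equality) (auto simp: S_def)
  show "mono (F 0 (critical_height F))" using Sup by (simp add: crit S)
  show "\<not> mono (F 0 b)" if "critical_height F < b"
    using upper[of b] that by (auto simp: crit S)
qed

text \<open>Just above the critical height there are points of negative derivative. A limit of such
  points has derivative at most 0, and at least 0 because the limiting map is monotone.\<close>

lemma critical_point_on_critical_line: "\<exists>x. deriv (F 0 (critical_height F)) x = 0"
proof -
  let ?c = "critical_height F"
  have cont: "continuous_on UNIV (\<lambda>(b, x). deriv (F 0 b) x)"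
  proof -
    have "continuous_on UNIV (\<lambda>(a, b, x). deriv (F a b) x)" by (rule class_N_D(3))
    moreover have "continuous_on UNIV (\<lambda>z :: real \<times> real. (0 :: real, fst z, snd z))"
      by (intro continuous_on_Pair continuous_on_const continuous_on_fst continuous_on_snd continuous_on_id)
    ultimately have "continuous_on UNIV (\<lambda>z. case (0, fst z, snd z) of (a, b, x) \<Rightarrow> deriv (F a b) x)"
      by (rule continuous_on_compose2) simp
    then show ?thesis by (simp add: case_prod_beta')
  qed
  have "\<exists>x. x \<in> {0..1} \<and> deriv (F 0 (?c + inverse (real (Suc n)))) x < 0" for n
  proof -
    let ?f = "F 0 (?c + inverse (real (Suc n)))"
    have "\<not> mono ?f" by (rule critical_height_mono(2)) simp
    then obtain y where y: "deriv ?f y < 0" using not_mono_deriv_neg[OF class_N_C3] by blast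
    obtain k where k: "0 \<le> y + of_int k" "y + of_int k < 1" by (rule lift_fundamental_domain)
    have "deriv ?f (y + of_int k) = deriv ?f y"
      using class_N_lift by (intro deriv_add_int class_N_C3) (simp add: degree_one_lift_iff)
    then show ?thesis using y k by (intro exI[of _ "y + of_int k"]) auto
  qed
  then obtain x where x: "\<And>n. x n \<in> {0..1}" "\<And>n. deriv (F 0 (?c + inverse (real (Suc n)))) (x n) < 0"
    by metis
  have "seq_compact {0..1::real}" using compact_imp_seq_compact by blast
  then obtain l r where l: "strict_mono r" "(x \<circ> r) \<longlonglongrightarrow> l"
    using seq_compactE[of "{0..1}" x] x(1) by blast
  have "(\<lambda>n. ?c + inverse (real (Suc n))) \<longlonglongrightarrow> ?c + 0"
    by (intro tendsto_intros LIMSEQ_inverse_real_of_nat)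
  then have "(\<lambda>n. ?c + inverse (real (Suc (r n)))) \<longlonglongrightarrow> ?c"
    using LIMSEQ_subseq_LIMSEQ[OF _ l(1), of "\<lambda>n. ?c + inverse (real (Suc n))" "?c + 0"]
    unfolding comp_def by simp
  then have pair: "(\<lambda>n. (?c + inverse (real (Suc (r n))), x (r n))) \<longlonglongrightarrow> (?c, l)"
    using l(2) by (intro tendsto_Pair) (simp_all add: comp_def)
  have "isCont (\<lambda>(b, x). deriv (F 0 b) x) (?c, l)"
    using cont by (simp add: continuous_on_eq_continuous_at)
  from isCont_tendsto_compose[OF this pair]
  have "(\<lambda>n. deriv (F 0 (?c + inverse (real (Suc (r n))))) (x (r n))) \<longlonglongrightarrow> deriv (F 0 ?c) l"
    by simp
  then have "deriv (F 0 ?c) l \<le> 0"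
    by (rule LIMSEQ_le_const2) (intro exI allI impI less_imp_le x(2))
  moreover have "deriv (F 0 ?c) l \<ge> 0"
    using critical_height_mono(1)
    by (rule deriv_nonneg_of_mono_minorant[OF _ _ _ C3_DERIV(1)[OF class_N_C3]]) simp_all
  ultimately show ?thesis by (intro exI[of _ l]) simp
qed

end

section \<open>Two turning points above the critical line\<close>

lemma DERIV_pos_less:
  assumes "C3 f" "x < y" "\<And>r. x < r \<Longrightarrow> r < y \<Longrightarrow> deriv f r > 0"
  shows "f x < f y"
proof (rule DERIV_pos_imp_increasing_open[OF assms(2)])
  show "continuous_on {x..y} f"
    by (rule continuous_on_subset[OF C3_continuous(1)[OF assms(1)]]) simp
  show "\<exists>l. (f has_real_derivative l) (at r) \<and> 0 < l" if "x < r" "r < y" for r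
    using assms(3)[OF that] C3_DERIV(1)[OF assms(1), of r] by blast
qed

lemma DERIV_neg_less:
  assumes "C3 f" "x < y" "\<And>r. x < r \<Longrightarrow> r < y \<Longrightarrow> deriv f r < 0"
  shows "f y < f x"
proof (rule DERIV_neg_imp_decreasing_open[OF assms(2)])
  show "continuous_on {x..y} f"
    by (rule continuous_on_subset[OF C3_continuous(1)[OF assms(1)]]) simp
  show "\<exists>l. (f has_real_derivative l) (at r) \<and> l < 0" if "x < r" "r < y" for r
    using assms(3)[OF that] C3_DERIV(1)[OF assms(1), of r] by blast
qed

lemma turning_max_deriv:
  assumes "C3 f" "turning_max f x"
  shows "deriv f x = 0"
proof -
  obtain e where e: "e > 0" "strict_mono_on {x - e..x} f" "strict_antimono_on {x..x + e} f"
    using assms(2) by (auto simp: turning_max_def)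
  have "f y \<le> f x" if "\<bar>x - y\<bar> < e" for y
    using monotone_onD[OF e(2), of y x] monotone_onD[OF e(3), of x y] that
    by (cases "y < x"; cases "y = x") auto
  then show ?thesis using DERIV_local_max[OF C3_DERIV(1)[OF assms(1)] e(1)] by blast
qed

lemma turning_min_deriv:
  assumes "C3 f" "turning_min f x"
  shows "deriv f x = 0"
proof -
  obtain e where e: "e > 0" "strict_antimono_on {x - e..x} f" "strict_mono_on {x..x + e} f"
    using assms(2) by (auto simp: turning_min_def)
  have "f y \<ge> f x" if "\<bar>x - y\<bar> < e" for y
    using monotone_onD[OF e(2), of y x] monotone_onD[OF e(3), of x y] that
    by (cases "y < x"; cases "y = x") auto
  then show ?thesis using DERIV_local_min[OF C3_DERIV(1)[OF assms(1)] e(1)] by blast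
qed

lemma not_turning_max_and_min: "\<not> (turning_max f x \<and> turning_min f x)"
proof
  assume "turning_max f x \<and> turning_min f x"
  then obtain d e where de: "d > 0" "strict_mono_on {x - d..x} f" "e > 0" "strict_antimono_on {x - e..x} f"
    by (auto simp: turning_max_def turning_min_def)
  have "f (x - min d e) < f x" "f x < f (x - min d e)"
    using de monotone_onD[OF de(2), of "x - min d e" x] monotone_onD[OF de(4), of "x - min d e" x]
    by auto
  then show False by simp
qed

lemma turning_maxI:
  assumes "C3 f" "u < x" "x < v" "\<And>r. u < r \<Longrightarrow> r < x \<Longrightarrow> deriv f r > 0"
    "\<And>r. x < r \<Longrightarrow> r < v \<Longrightarrow> deriv f r < 0"
  shows "turning_max f x"
  unfolding turning_max_def
proof (intro exI conjI)
  let ?e = "min (x - u) (v - x)"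
  show "?e > 0" using assms by simp
  show "strict_mono_on {x - ?e..x} f"
    by (rule monotone_onI, rule DERIV_pos_less[OF assms(1)]) (use assms(4,5) in auto)
  show "strict_antimono_on {x..x + ?e} f"
    by (rule monotone_onI, rule DERIV_neg_less[OF assms(1)]) (use assms(4,5) in auto)
qed

lemma turning_minI:
  assumes "C3 f" "u < x" "x < v" "\<And>r. u < r \<Longrightarrow> r < x \<Longrightarrow> deriv f r < 0"
    "\<And>r. x < r \<Longrightarrow> r < v \<Longrightarrow> deriv f r > 0"
  shows "turning_min f x"
  unfolding turning_min_def
proof (intro exI conjI)
  let ?e = "min (x - u) (v - x)"
  show "?e > 0" using assms by simp
  show "strict_antimono_on {x - ?e..x} f"
    by (rule monotone_onI, rule DERIV_neg_less[OF assms(1)]) (use assms(4,5) in auto)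
  show "strict_mono_on {x..x + ?e} f"
    by (rule monotone_onI, rule DERIV_pos_less[OF assms(1)]) (use assms(4,5) in auto)
qed

text \<open>\<open>\<alpha>\<close> and \<open>\<beta>\<close> are the zeros nearest to
  \<open>t\<close> on either side, found as the last and first points where \<open>D\<close> is
  nonnegative.\<close>

lemma negative_gap:
  fixes D :: "real \<Rightarrow> real"
  assumes cont: "continuous_on UNIV D" and "s < t" "t < w" "D s > 0" "D t < 0" "D w > 0"
  obtains \<alpha> \<beta> where "s < \<alpha>" "\<alpha> < t" "t < \<beta>" "\<beta> < w" "D \<alpha> = 0" "D \<beta> = 0"
    "\<And>r. \<alpha> < r \<Longrightarrow> r < \<beta> \<Longrightarrow> D r < 0"
proof -
  define A where "A = {r \<in> {s..t}. D r \<ge> 0}"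
  define B where "B = {r \<in> {t..w}. D r \<ge> 0}"
  have "closed {r. D r \<ge> 0}" by (intro closed_Collect_le cont continuous_intros)
  moreover have "A = {s..t} \<inter> {r. D r \<ge> 0}" "B = {t..w} \<inter> {r. D r \<ge> 0}"
    by (auto simp: A_def B_def)
  ultimately have AB: "closed A" "closed B" by auto
  have ne: "s \<in> A" "w \<in> B" using assms by (auto simp: A_def B_def)
  have bdd: "bdd_above A" "bdd_below B" by (auto simp: A_def B_def bdd_above_def bdd_below_def)
  have \<alpha>: "Sup A \<in> A" using closed_contains_Sup[OF _ bdd(1) AB(1)] ne by auto
  have \<beta>: "Inf B \<in> B" using closed_contains_Inf[OF _ bdd(2) AB(2)] ne by auto
  have neg: "D r < 0" if "Sup A < r" "r < Inf B" for r
  proof (rule ccontr)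
    assume "\<not> D r < 0"
    then have "r \<in> A \<or> r \<in> B" using that \<alpha> \<beta> by (auto simp: A_def B_def)
    then show False using cSup_upper[OF _ bdd(1), of r] cInf_lower[OF _ bdd(2), of r] that by auto
  qed
  have \<alpha>0: "D (Sup A) = 0"
  proof (rule ccontr)
    assume "D (Sup A) \<noteq> 0"
    then have "D (Sup A) > 0" using \<alpha> by (auto simp: A_def)
    then have "\<exists>r\<ge>Sup A. r \<le> t \<and> D r = 0"
      using \<alpha> assms by (intro IVT2') (auto simp: A_def intro: continuous_on_subset[OF cont])
    then obtain r where r: "r \<ge> Sup A" "r \<le> t" "D r = 0" by blast
    then have "r \<in> A" using \<alpha> by (auto simp: A_def)
    then have "r = Sup A" using cSup_upper[OF _ bdd(1)] r by force
    then show False using r \<open>D (Sup A) > 0\<close> by simp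
  qed
  have \<beta>0: "D (Inf B) = 0"
  proof (rule ccontr)
    assume "D (Inf B) \<noteq> 0"
    then have "D (Inf B) > 0" using \<beta> by (auto simp: B_def)
    then have "\<exists>r\<ge>t. r \<le> Inf B \<and> D r = 0"
      using \<beta> assms by (intro IVT') (auto simp: B_def intro: continuous_on_subset[OF cont])
    then obtain r where r: "r \<ge> t" "r \<le> Inf B" "D r = 0" by blast
    then have "r \<in> B" using \<beta> by (auto simp: B_def)
    then have "r = Inf B" using cInf_lower[OF _ bdd(2)] r by force
    then show False using r \<open>D (Inf B) > 0\<close> by simp
  qed
  have "Sup A \<noteq> s" "Sup A \<noteq> t" "Inf B \<noteq> t" "Inf B \<noteq> w" using \<alpha>0 \<beta>0 assms by auto
  then show ?thesis
    using \<alpha> \<beta> by (intro that[of "Sup A" "Inf B"] \<alpha>0 \<beta>0 neg) (auto simp: A_def B_def)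
qed

text \<open>A gap of negative derivative has a zero at each end, and these exhaust the at most two
  critical points per period. So the derivative has no zero on the rest of the period and is
  positive there, because it equals 1 somewhere.\<close>

lemma class_B_turning_points:
  assumes B: "class_B f" and "\<not> mono f" and less: "max_loc f < min_loc f"
  shows "min_loc f < max_loc f + 1" "card (critical_points f) = 2"
    "\<And>r. max_loc f < r \<Longrightarrow> r < min_loc f \<Longrightarrow> deriv f r < 0"
    "\<And>r. min_loc f < r \<Longrightarrow> r < max_loc f + 1 \<Longrightarrow> deriv f r > 0"
proof -
  have lift: "is_lift f" and C: "C3 f" and fin: "finite (critical_points f)"
    and card: "card (critical_points f) \<le> 2"
    using B by (auto simp: class_B_def degree_one_lift_iff)
  let ?D = "deriv f"
  note per = deriv_add_int[OF lift C]
  note cont = C3_continuous(2)[OF C]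
  obtain t where t: "?D t < 0" using not_mono_deriv_neg[OF C \<open>\<not> mono f\<close>] by blast
  have "f (t + 1) = f t + 1" using lift by (simp add: is_lift_def)
  then obtain w where w: "t < w" "w < t + 1" "?D w = 1"
    using MVT2[of t "t + 1" f ?D] C3_DERIV(1)[OF C] by auto
  have w': "?D (w - 1) = 1" using per[of w "-1"] w by simp
  obtain \<alpha>0 \<beta>0 where ab0: "w - 1 < \<alpha>0" "\<alpha>0 < t" "t < \<beta>0" "\<beta>0 < w" "?D \<alpha>0 = 0" "?D \<beta>0 = 0"
    "\<And>r. \<alpha>0 < r \<Longrightarrow> r < \<beta>0 \<Longrightarrow> ?D r < 0"
    using negative_gap[OF cont, of "w - 1" t w] w w' t by auto
  define n where "n = - \<lfloor>\<alpha>0\<rfloor>"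
  define \<alpha> where "\<alpha> = \<alpha>0 + of_int n"
  define \<beta> where "\<beta> = \<beta>0 + of_int n"
  have \<alpha>01: "0 \<le> \<alpha>" "\<alpha> < 1" unfolding \<alpha>_def n_def of_int_minus by linarith+
  have ab: "\<alpha> < \<beta>" "\<beta> < \<alpha> + 1" "?D \<alpha> = 0" "?D \<beta> = 0"
    using ab0 by (auto simp: \<alpha>_def \<beta>_def per)
  have neg: "?D r < 0" if "\<alpha> < r" "r < \<beta>" for r
    using ab0(7)[of "r + of_int (- n)"] that unfolding per by (simp add: \<alpha>_def \<beta>_def)
  \<comment> \<open>The right end of the gap may lie beyond 1; this is its representative in
    \<open>[0, 1)\<close>.\<close>
  define \<beta>' where "\<beta>' = (if \<beta> < 1 then \<beta> else \<beta> - 1)"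
  have crit': "\<alpha> \<in> critical_points f" "\<beta>' \<in> critical_points f"
    using ab \<alpha>01 per[of \<beta> "-1"] by (auto simp: critical_points_def \<beta>'_def)
  have ne: "\<alpha> \<noteq> \<beta>'" using ab by (auto simp: \<beta>'_def)
  then have "card {\<alpha>, \<beta>'} = 2" by simp
  moreover have "card {\<alpha>, \<beta>'} \<le> card (critical_points f)"
    using crit' by (intro card_mono fin) auto
  ultimately have card2: "card (critical_points f) = 2" using card by simp
  then have crit: "critical_points f = {\<alpha>, \<beta>'}"
    using card_subset_eq[OF fin, of "{\<alpha>, \<beta>'}"] crit' \<open>card {\<alpha>, \<beta>'} = 2\<close> by auto
  have nz: "?D r \<noteq> 0" if "\<beta> < r" "r < \<alpha> + 1" for r
  proof
    assume "?D r = 0"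
    then have "r \<in> critical_points f \<or> r - 1 \<in> critical_points f"
      using that ab \<alpha>01 per[of r "-1"] by (auto simp: critical_points_def)
    then show False using that ab unfolding crit \<beta>'_def by (auto split: if_splits)
  qed
  define w1 where "w1 = w + of_int n"
  have w1: "\<beta> < w1" "w1 < \<alpha> + 1" "?D w1 > 0"
    using w ab0 by (auto simp: w1_def \<alpha>_def \<beta>_def per)
  have pos: "?D r > 0" if r: "\<beta> < r" "r < \<alpha> + 1" for r
  proof (rule ccontr)
    assume "\<not> ?D r > 0"
    then have "?D r \<le> 0" by simp
    then have "\<exists>z. min r w1 \<le> z \<and> z \<le> max r w1 \<and> ?D z = 0"
      using IVT'[of ?D r 0 w1] IVT2'[of ?D r 0 w1] w1 continuous_on_subset[OF cont]
      by (cases "r \<le> w1") (auto simp: min_def max_def)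
    then obtain z where "min r w1 \<le> z" "z \<le> max r w1" "?D z = 0" by blast
    then show False using nz[of z] r w1 by (auto simp: min_def max_def split: if_splits)
  qed
  have pos': "?D r > 0" if "\<beta> - 1 < r" "r < \<alpha>" for r
    using pos[of "r + of_int 1"] that unfolding per by simp
  have neg': "?D r < 0" if "\<alpha> - 1 < r" "r < \<beta> - 1" for r
    using neg[of "r + of_int 1"] that unfolding per by simp
  have max: "turning_max f \<alpha>"
    using ab by (intro turning_maxI[OF C, of "\<beta> - 1" \<alpha> \<beta>] pos' neg) auto
  have min: "turning_min f \<beta>'"
  proof (cases "\<beta> < 1")
    case True
    then show ?thesis
      using ab turning_minI[OF C, of \<alpha> \<beta> "\<alpha> + 1"] pos neg by (simp add: \<beta>'_def)
  next
    case False
    then show ?thesis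
      using ab turning_minI[OF C, of "\<alpha> - 1" "\<beta> - 1" \<alpha>] pos' neg' by (simp add: \<beta>'_def)
  qed
  have max_loc: "max_loc f = \<alpha>"
    unfolding max_loc_def
  proof (rule the_equality)
    fix x assume x: "x \<in> {0..<1} \<and> turning_max f x"
    then have "x \<in> critical_points f" using turning_max_deriv[OF C] by (simp add: critical_points_def)
    then show "x = \<alpha>" using x min not_turning_max_and_min by (auto simp: crit)
  qed (use max \<alpha>01 in auto)
  have min_loc: "min_loc f = \<beta>'"
    unfolding min_loc_def
  proof (rule the_equality)
    fix x assume x: "x \<in> {0..<1} \<and> turning_min f x"
    then have "x \<in> critical_points f" using turning_min_deriv[OF C] by (simp add: critical_points_def)
    then show "x = \<beta>'" using x max not_turning_max_and_min by (auto simp: crit)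
  qed (use min crit' in \<open>auto simp: critical_points_def\<close>)
  \<comment> \<open>The choice of origin, maximum before minimum, excludes the wrapped case.\<close>
  have "\<beta>' = \<beta>" using less ab unfolding max_loc min_loc by (auto simp: \<beta>'_def split: if_splits)
  then show "min_loc f < max_loc f + 1" "card (critical_points f) = 2"
    "\<And>r. max_loc f < r \<Longrightarrow> r < min_loc f \<Longrightarrow> deriv f r < 0"
    "\<And>r. min_loc f < r \<Longrightarrow> r < max_loc f + 1 \<Longrightarrow> deriv f r > 0"
    using ab card2 neg pos by (simp_all add: max_loc min_loc)
qed

section \<open>Tips\<close>

lemma translate_bimodal:
  assumes "bimodal f C K Km Cp"
  shows "bimodal (\<lambda>x. f x + a) C K Km Cp"
proof -
  interpret bimodal f C K Km Cp by fact
  show ?thesis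
  proof
    show "degree_one_lift (\<lambda>x. f x + a)"
      using f by (auto simp: degree_one_lift_def intro: continuous_intros)
    show "strict_antimono_on {C..K} (\<lambda>x. f x + a)" "strict_mono_on {K..C + 1} (\<lambda>x. f x + a)"
      using dec inc by (simp_all add: monotone_on_def)
  qed (use CK Km Cp in auto)
qed

text \<open>On an increasing branch \<open>f\<close> rises from \<open>f K - 1\<close> to
  \<open>f C\<close> and, one period later, from \<open>f K\<close> to \<open>f C + 1\<close>. It
  takes the values \<open>f K\<close> and \<open>f C\<close> there once each, which determines
  \<open>GREATEST\<close> and \<open>LEAST\<close>.\<close>

lemma turning_points_bimodal:
  assumes f: "degree_one_lift f" and C3: "C3 f" and CK: "C < K" "K < C + 1"
    and neg: "\<And>r. C < r \<Longrightarrow> r < K \<Longrightarrow> deriv f r < 0"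
    and pos: "\<And>r. K < r \<Longrightarrow> r < C + 1 \<Longrightarrow> deriv f r > 0"
  shows "bimodal f C K (GREATEST y. y < K \<and> f y = f K) (LEAST y. C < y \<and> f y = f C)"
proof -
  have f1: "f (x + 1) = f x + 1" and cont: "continuous_on UNIV f" for x
    using f by (auto simp: degree_one_lift_def)
  have dec: "f y < f x" if "C \<le> x" "x < y" "y \<le> K" for x y
    by (rule DERIV_neg_less[OF C3]) (use that neg in auto)
  have inc: "f x < f y" if "K \<le> x" "x < y" "y \<le> C + 1" for x y
    by (rule DERIV_pos_less[OF C3]) (use that pos in auto)
  have inc': "f x < f y" if "K - 1 \<le> x" "x < y" "y \<le> C" for x y
    using inc[of "x + 1" "y + 1"] that by (simp add: f1)
  have CK': "f K < f C" by (rule dec) (use CK in auto)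
  have "\<exists>y\<ge>K - 1. y \<le> C \<and> f y = f K"
    using f1[of "K - 1"] CK CK' by (intro IVT') (auto intro: continuous_on_subset[OF cont])
  then obtain u where u: "K - 1 \<le> u" "u \<le> C" "f u = f K" by blast
  then have u': "K - 1 < u" "u < C" using f1[of "K - 1"] CK' by (auto simp: le_less)
  have Km: "(GREATEST y. y < K \<and> f y = f K) = u"
  proof (rule Greatest_equality)
    show "u < K \<and> f u = f K" using u u' CK by simp
    fix y assume y: "y < K \<and> f y = f K"
    show "y \<le> u"
    proof (rule ccontr)
      assume "\<not> y \<le> u"
      then show False using inc'[of u y] dec[of y K] y u u' by (cases "y \<le> C") auto
    qed
  qed
  have "\<exists>y\<ge>K. y \<le> C + 1 \<and> f y = f C"
    using f1[of C] CK CK' by (intro IVT') (auto intro: continuous_on_subset[OF cont])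
  then obtain v where v: "K \<le> v" "v \<le> C + 1" "f v = f C" by blast
  then have v': "K < v" "v < C + 1" using f1[of C] CK' by (auto simp: le_less)
  have Cp: "(LEAST y. C < y \<and> f y = f C) = v"
  proof (rule Least_equality)
    show "C < v \<and> f v = f C" using v v' CK by simp
    fix y assume y: "C < y \<and> f y = f C"
    show "v \<le> y"
    proof (rule ccontr)
      assume "\<not> v \<le> y"
      then show False using inc[of y v] dec[of C y] y v v' by (cases "K \<le> y") auto
    qed
  qed
  show ?thesis
    unfolding Km Cp
  proof
    show "strict_antimono_on {C..K} f" by (intro monotone_onI) (auto intro: dec)
    show "strict_mono_on {K..C + 1} f" by (intro monotone_onI) (auto intro: inc)
  qed (use f CK u u' v v' in auto)
qed

lemma deriv_translate:
  assumes "C3 f"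
  shows "deriv (\<lambda>x. f x + a) = deriv f"
proof
  fix x
  have "((\<lambda>x. f x + a) has_real_derivative deriv f x) (at x)"
    by (auto intro!: derivative_eq_intros C3_DERIV(1)[OF assms])
  then show "deriv (\<lambda>x. f x + a) x = deriv f x" by (rule DERIV_imp_deriv)
qed

context
  fixes F :: family
  assumes N: "class_N F"
begin

lemma F_translate: "F a b = (\<lambda>x. F 0 b x + a)"
  by (rule ext) (rule class_N_D(4)[OF N])

lemma F_deriv: "deriv (F a b) = deriv (F 0 b)"
  unfolding F_translate[of a b] by (rule deriv_translate[OF class_N_C3[OF N]])

lemma above_critical_line:
  assumes "critical_height F < b"
  shows "bimodal (F a b) (C_pt F b) (K_pt F b) (K_minus F b) (C_plus F b)"
    and "negative_schwarzian (F a b)"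
    and "K_pt F b < r \<Longrightarrow> r < C_pt F b + 1 \<Longrightarrow> deriv (F a b) r > 0"
proof -
  let ?f = "F 0 b"
  have eq: "C_pt F b = max_loc ?f" "K_pt F b = min_loc ?f"
    "K_minus F b = (GREATEST y. y < K_pt F b \<and> ?f y = ?f (K_pt F b))"
    "C_plus F b = (LEAST y. C_pt F b < y \<and> ?f y = ?f (C_pt F b))"
    using assms by (simp_all add: C_pt_def K_pt_def K_minus_def C_plus_def)
  have less: "max_loc ?f < min_loc ?f"
    using class_N_D(8)[OF N assms] unfolding eq(1,2) .
  note tp = class_B_turning_points[OF class_N_D(1)[OF N] critical_height_mono(2)[OF N assms] less]
  have "bimodal ?f (C_pt F b) (K_pt F b) (K_minus F b) (C_plus F b)"
    unfolding eq(3,4) unfolding eq(1,2)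
    by (rule turning_points_bimodal[OF class_N_lift[OF N] class_N_C3[OF N] less tp(1,3,4)])
  then show "bimodal (F a b) (C_pt F b) (K_pt F b) (K_minus F b) (C_plus F b)"
    unfolding F_translate[of a b] by (rule translate_bimodal)
  have "card (critical_points (F a b)) = 2"
    using tp(2) by (simp add: critical_points_def F_deriv[of a b])
  then show "negative_schwarzian (F a b)"
    using class_N_D(1)[OF N, of a b] by (simp add: class_B_def negative_schwarzian_def)
  show "deriv (F a b) r > 0" if "K_pt F b < r" "r < C_pt F b + 1"
    using tp(4) that unfolding F_deriv[of a b] eq(1,2) by simp
qed

lemma tip_bounds:
  assumes tip: "is_tip F (real p / real q) (a, b)" and "q > 0"
  shows "(lower_bound (F a b) ^^ q) x \<le> x + of_int (int p)"
    and "(upper_bound (F a b) ^^ q) x \<ge> x + of_int (int p)"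
    and "periodic_set (lower_bound (F a b)) q (int p) \<noteq> {}"
    and "periodic_set (upper_bound (F a b)) q (int p) \<noteq> {}"
proof -
  let ?f = "F a b"
  have f: "degree_one_lift ?f" by (rule class_N_lift[OF N])
  have rot: "Rot ?f = {of_int (int p) / real q}" using tip by (auto simp: is_tip_def Lock_def)
  have uniq: "c = 0" if "Rot (\<lambda>x. ?f x + c) = {of_int (int p) / real q}" for c
  proof -
    have "(\<lambda>x. ?f x + c) = F (a + c) b"
      unfolding F_translate[of a b] F_translate[of "a + c" b] by (simp add: add.assoc)
    then have "(a + c, b) \<in> Lock F (real p / real q)" using that by (simp add: Lock_def)
    then show ?thesis using tip by (simp add: is_tip_def)
  qed
  show "(lower_bound ?f ^^ q) x \<le> x + of_int (int p)"
    by (rule tip_lower_bound_le[OF f \<open>q > 0\<close> rot uniq])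
  show "(upper_bound ?f ^^ q) x \<ge> x + of_int (int p)"
    by (rule tip_upper_bound_ge[OF f \<open>q > 0\<close> rot uniq])
  show "periodic_set (lower_bound ?f) q (int p) \<noteq> {}"
    using periodic_point_exists[OF mono_lower_bound[OF f] is_lift_lower_bound[OF f]
        continuous_on_lower_bound[OF f] \<open>q > 0\<close> Rot_lower_bound[OF f rot]]
    by (auto simp: periodic_set_def)
  show "periodic_set (upper_bound ?f) q (int p) \<noteq> {}"
    using degree_one_lift_upper_bound[OF f]
      periodic_point_exists[OF mono_upper_bound[OF f] _ _ \<open>q > 0\<close> Rot_upper_bound[OF f rot]]
    by (auto simp: periodic_set_def degree_one_lift_iff)
qed

text \<open>On the critical line a tip would force the \<open>q\<close>-th iterate to be a translation, although its
  derivative vanishes at the critical point.\<close>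

lemma tip_above_critical_line:
  assumes tip: "is_tip F (real p / real q) (a, b)" and "q > 0"
  shows "critical_height F < b"
proof (rule ccontr)
  let ?f = "F a b"
  assume "\<not> critical_height F < b"
  then have b: "b = critical_height F" using tip by (simp add: is_tip_def)
  have "mono ?f"
    using critical_height_mono(1)[OF N] unfolding b[symmetric] F_translate[of a b]
    by (simp add: mono_def)
  then have "(?f ^^ q) x = x + real p" for x
    using tip_bounds(1,2)[OF assms, of x]
    by (simp add: lower_bound_mono_eq upper_bound_mono_eq)
  then have "(?f ^^ q) = (\<lambda>x. x + real p)" by (rule ext)
  then have one: "((?f ^^ q) has_real_derivative 1) (at x)" for x
    by (auto intro!: derivative_eq_intros)
  obtain c where c: "deriv ?f c = 0"
    using critical_point_on_critical_line[OF N] unfolding b[symmetric] F_deriv[of a b] by blast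
  have "(\<Prod>j<q. deriv ?f ((?f ^^ j) c)) = 1"
    using DERIV_funpow[OF C3_DERIV(1)[OF class_N_C3[OF N]]] one by (rule DERIV_unique)
  moreover have "(\<Prod>j<q. deriv ?f ((?f ^^ j) c)) = 0"
    using \<open>q > 0\<close> c by (intro prod_zero) (auto intro!: bexI[of _ 0])
  ultimately show False by simp
qed

lemma tip_bimodal:
  assumes tip: "is_tip F (real p / real q) (a, b)" and "q > 0"
    and det: "int q' * int p - p' * int q = 1"
  shows "bimodal_tip (F a b) (C_pt F b) (K_pt F b) (K_minus F b) (C_plus F b) q p q' p'"
proof -
  note b = tip_above_critical_line[OF assms(1,2)]
  interpret bimodal "F a b" "C_pt F b" "K_pt F b" "K_minus F b" "C_plus F b"
    by (rule above_critical_line(1)[OF b])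
  show ?thesis
    by unfold_locales
      (fact above_critical_line(2)[OF b] above_critical_line(3)[OF b] assms(2) det
        tip_bounds(1,2)[OF assms(1,2)])+
qed

lemma tip_in_R_locus:
  fixes p q p' q' :: nat
  assumes tip: "is_tip F (real p / real q) T" and "q > 0" "p > 0"
    and det: "int q' * int p - int p' * int q = 1"
  shows "T \<in> R_locus F p' q'"
proof -
  obtain a b where T: "T = (a, b)" by (cases T)
  note tip = tip[unfolded T]
  interpret bimodal_tip "F a b" "C_pt F b" "K_pt F b" "K_minus F b" "C_plus F b" q p q' "int p'"
    by (rule tip_bimodal[OF tip \<open>q > 0\<close> det])
  note orb = Km_orbit[OF tip_bounds(3,4)[OF tip \<open>q > 0\<close>]]
  have "(F a b ^^ i) (K_minus F b) \<notin> plus_Ints {K_minus F b<..K_pt F b}" for i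
  proof
    assume "(F a b ^^ i) (K_minus F b) \<in> plus_Ints {K_minus F b<..K_pt F b}"
    then obtain x n where "x \<in> {K_minus F b<..K_pt F b}" "(F a b ^^ i) (K_minus F b) = x + of_int n"
      by (auto simp: plus_Ints_def)
    then show False using orb(2)[of n i] by simp
  qed
  then show ?thesis
    using tip_above_critical_line[OF tip \<open>q > 0\<close>] orb(1) orb(3)[OF \<open>p > 0\<close>]
    by (simp add: R_locus_def T)
qed

lemma tip_in_L_locus:
  fixes p q p' q' :: nat
  assumes tip: "is_tip F (real p / real q) T" and "q > 0"
    and neighbors: "int p' * int q - int q' * int p = 1"
  shows "T \<in> L_return F p' q'" and "p > 0 \<Longrightarrow> T \<in> L_locus F p' q'"
proof -
  obtain a b where T: "T = (a, b)" by (cases T)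
  note tip = tip[unfolded T]
  \<comment> \<open>Here the determinant has the opposite sign. Adding \<open>q'\<close> times
    \<open>(q, p)\<close> to \<open>(- q', - p')\<close> gives the pair
    \<open>(q' * (q - 1), q' * p - p')\<close>, which has the right one and a natural first
    entry.\<close>
  obtain q0 where q0: "q = Suc q0" using \<open>q > 0\<close> gr0_implies_Suc by blast
  have "int (q' * q0) * int p - (int q' * int p - int p') * int q = 1"
    using neighbors unfolding q0 by (simp add: algebra_simps)
  from tip_bimodal[OF tip \<open>q > 0\<close> this]
  interpret bimodal_tip "F a b" "C_pt F b" "K_pt F b" "K_minus F b" "C_plus F b" q p "q' * q0"
    "int q' * int p - int p'" .
  note orb = Cp_orbit[OF tip_bounds(3,4)[OF tip \<open>q > 0\<close>] neighbors]
  have "(F a b ^^ i) (C_plus F b) \<notin> plus_Ints {C_pt F b..<C_plus F b}" for i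
  proof
    assume "(F a b ^^ i) (C_plus F b) \<in> plus_Ints {C_pt F b..<C_plus F b}"
    then obtain x n where "x \<in> {C_pt F b..<C_plus F b}" "(F a b ^^ i) (C_plus F b) = x + of_int n"
      by (auto simp: plus_Ints_def)
    then show False using orb(2)[of n i] by simp
  qed
  then show ret: "T \<in> L_return F p' q'"
    using tip_above_critical_line[OF tip \<open>q > 0\<close>] orb(1) by (simp add: L_return_def T)
  show "p > 0 \<Longrightarrow> T \<in> L_locus F p' q'" using ret orb(3) by (simp add: L_locus_def T)
qed

end

theorem theorem2:
  fixes F :: "real \<Rightarrow> real \<Rightarrow> real \<Rightarrow> real"
    and p q p1 q1 p2 q2 :: nat
  assumes "class_N F"
    and "farey_parents p q p1 q1 p2 q2"
  shows "\<forall>j::nat.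
    (\<forall>T. is_tip F (real (j * p + p1) / real (j * q + q1)) T \<longrightarrow>
       T \<in> L_return F p q \<and> (j * p + p1 \<noteq> 0 \<longrightarrow> T \<in> L_locus F p q)) \<and>
    (\<forall>T. is_tip F (real (j * p + p2) / real (j * q + q2)) T \<longrightarrow>
       T \<in> R_locus F p q) \<and>
    (\<forall>T. is_tip F (real p / real q) T \<longrightarrow>
       T \<in> R_locus F (j * p + p1) (j * q + q1) \<and>
       T \<in> L_locus F (j * p + p2) (j * q + q2))"
proof -
  note farey = assms(2)[unfolded farey_parents_def reduced_frac_def]
  have q: "q > 0" "q1 > 0" "q2 > 0" and sum: "p = p1 + p2" "q = q1 + q2" using farey by auto
  have "real p1 / real q1 < real p2 / real q2" using farey by simp
  then have "real (p1 * q2) < real (p2 * q1)" using q by (simp add: field_simps)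
  then have less: "int p1 * int q2 < int p2 * int q1" by (simp flip: of_nat_mult)
  then have det: "int p2 * int q1 - int p1 * int q2 = 1"
    using farey unfolding farey_neighbors_def by linarith
  \<comment> \<open>The right parent is positive, hence so are \<open>p / q\<close> and all
    \<open>r_j\<close>; only \<open>l_0\<close> can be 0.\<close>
  have "0 \<le> int p1 * int q2" by simp
  then have "0 < int p2 * int q1" using less by linarith
  then have "p2 \<noteq> 0" by (intro notI) simp
  then have pos: "p > 0" "j * p + p2 > 0" for j using sum by auto
  \<comment> \<open>The terms with \<open>j\<close> cancel, leaving the determinant of the two
    parents.\<close>
  have l: "int p * int (j * q + q1) - int q * int (j * p + p1) = 1"
    and r: "int q * int (j * p + p2) - int p * int (j * q + q2) = 1" for j
    using det unfolding sum by (simp_all add: algebra_simps)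
  show ?thesis
  proof (intro allI conjI impI)
    fix j T
    assume tip: "is_tip F (real (j * p + p1) / real (j * q + q1)) T"
    note L = tip_in_L_locus[OF assms(1) tip _ l]
    show "T \<in> L_return F p q" using L(1) q by simp
    show "T \<in> L_locus F p q" if "j * p + p1 \<noteq> 0" using L(2) q that by simp
  next
    fix j T
    assume "is_tip F (real (j * p + p2) / real (j * q + q2)) T"
    then show "T \<in> R_locus F p q" by (rule tip_in_R_locus[OF assms(1) _ _ pos(2) r]) (use q in simp)
  next
    fix j T
    assume tip: "is_tip F (real p / real q) T"
    show "T \<in> R_locus F (j * p + p1) (j * q + q1)"
      by (rule tip_in_R_locus[OF assms(1) tip q(1) pos(1)]) (use l[of j] in \<open>simp add: algebra_simps\<close>)
    show "T \<in> L_locus F (j * p + p2) (j * q + q2)"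
      by (rule tip_in_L_locus(2)[OF assms(1) tip q(1) _ pos(1)]) (use r[of j] in \<open>simp add: algebra_simps\<close>)
  qed
qed

end
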